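(* For $\lambda\in(0,1/e)$ let $E_\lambda(z)=\lambda e^z$, $z\in\mathbb{C}$. There exists $\lambda_0\in(0,1/e)$ such that for all $0<\lambda\le\lambda_0$ $$1+\frac12\,\frac{\log\log\log(1/\lambda)}{\log\log(1/\lambda)}-\frac{\log\log\log\log(1/\lambda)}{\log\log(1/\lambda)}<\dim J_{\mathrm{bd}}(E_\lambda)\le\dim J_{\mathrm{r}}(E_\lambda)\le 1+\frac{\log\log\log(1/\lambda)}{\log\log(1/\lambda)}.$$
   Context: $\dim$ denotes Hausdorff dimension. For an entire function $f$ the Julia set $J(f)$ is the set where the iterates $f^n$ do not form a normal family, and the escaping set $I(f)$ is the set of points $z$ with $f^n(z)\to\infty$. For $0<\lambda<1/e$, $E_\lambda$ has an attracting fixed point and $J(E_\lambda)$ is the complement of its attracting basin. $J_{\mathrm{bd}}(E_\lambda)$ is the set of all $z\in J(E_\lambda)$ whose orbit $\{E_\lambda^n(z): n\in\mathbb{N}\}$ is bounded, and $J_{\mathrm{r}}(E_\lambda)=J(E_\lambda)\setminus I(E_\lambda)$. *)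

theory Defs
  imports "HOL-Complex_Analysis.Complex_Analysis"
begin

text \<open>
  The library has \<open>0 powr 0 = 0\<close>, whereas the \<open>0\<close>-th power of the diameter of a nonempty
  set has to be \<open>1\<close> (so that the \<open>0\<close>-dimensional Hausdorff measure is counting measure);
  the empty set always contributes \<open>0\<close>.
\<close>

definition diam_power :: "real \<Rightarrow> 'a::metric_space set \<Rightarrow> ennreal" where
  "diam_power s U =
    (if U = {} then 0 else if s = 0 then 1 else ennreal (diameter U powr s))"

text \<open>Boundedness is required separately because \<^const>\<open>diameter\<close> is unspecified on unbounded sets.\<close>

definition hausdorff_premeasure :: "real \<Rightarrow> real \<Rightarrow> 'a::metric_space set \<Rightarrow> ennreal" where
  "hausdorff_premeasure s \<delta> A =
    (INF U \<in> {U :: nat \<Rightarrow> 'a set. A \<subseteq> (\<Union>i. U i) \<and> (\<forall>i. bounded (U i) \<and> diameter (U i) \<le> \<delta>)}.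
       \<Sum>i. diam_power s (U i))"

definition hausdorff_measure :: "real \<Rightarrow> 'a::metric_space set \<Rightarrow> ennreal" where
  "hausdorff_measure s A = (SUP \<delta>\<in>{0<..}. hausdorff_premeasure s \<delta> A)"

definition hausdorff_dim :: "'a::metric_space set \<Rightarrow> ereal" where
  "hausdorff_dim A = Inf {ereal s |s. 0 \<le> s \<and> hausdorff_measure s A = 0}"

text \<open>
  Normality in the sense of Montel, for families of holomorphic functions on a domain \<open>D\<close>:
  locally uniform convergence in the spherical metric amounts to locally uniform convergence
  to a holomorphic function or to the constant \<open>\<infinity>\<close>, as \<open>D\<close> is connected.
\<close>

definition normal_family_on :: "complex set \<Rightarrow> (complex \<Rightarrow> complex) set \<Rightarrow> bool" where
  "normal_family_on D \<F> \<longleftrightarrow>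
    (\<forall>h\<in>\<F>. h holomorphic_on D) \<and>
    (\<forall>F :: nat \<Rightarrow> complex \<Rightarrow> complex. range F \<subseteq> \<F> \<longrightarrow>
      (\<exists>r :: nat \<Rightarrow> nat. strict_mono r \<and>
        ((\<exists>g. g holomorphic_on D \<and>
              (\<forall>K. compact K \<and> K \<subseteq> D \<longrightarrow> uniform_limit K (F \<circ> r) g sequentially)) \<or>
         (\<forall>K. compact K \<and> K \<subseteq> D \<longrightarrow>
              (\<forall>B. \<forall>\<^sub>F n in sequentially. \<forall>z\<in>K. B < norm (F (r n) z))))))"

definition fatou_set :: "(complex \<Rightarrow> complex) \<Rightarrow> complex set" where
  "fatou_set f =
    {z. \<exists>D. open D \<and> connected D \<and> z \<in> D \<and> normal_family_on D (range (\<lambda>n. f ^^ n))}"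

definition julia_set :: "(complex \<Rightarrow> complex) \<Rightarrow> complex set" where
  "julia_set f = - fatou_set f"

definition escaping_set :: "(complex \<Rightarrow> complex) \<Rightarrow> complex set" where
  "escaping_set f = {z. filterlim (\<lambda>n. (f ^^ n) z) at_infinity sequentially}"

definition julia_bd :: "(complex \<Rightarrow> complex) \<Rightarrow> complex set" where
  "julia_bd f = {z \<in> julia_set f. bounded (range (\<lambda>n. (f ^^ n) z))}"

definition julia_r :: "(complex \<Rightarrow> complex) \<Rightarrow> complex set" where
  "julia_r f = julia_set f - escaping_set f"

definition exp_map :: "real \<Rightarrow> complex \<Rightarrow> complex" where
  "exp_map c z = of_real c * exp z"

end

theory Submission
  imports Defs "HOL-Real_Asymp.Real_Asymp"
begin

text \<open>
  Write \<open>L = ln (1/c)\<close>, so that the map is \<open>E z = exp (z - L)\<close>, with inverse branches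
  \<open>\<phi>\<^sub>k w = Ln w + L + 2\<pi>ik\<close> on the right half-plane and \<open>\<bar>\<phi>\<^sub>k' w\<bar> = 1 / \<bar>w\<bar>\<close>. The half-plane
  \<open>Re z < L\<close> is mapped into the unit disc, hence into itself, and so lies in the Fatou set; the Julia
  set is contained in the set of points whose orbit stays in \<open>H = {Re z \<ge> L}\<close>
  (\<open>julia_orbit_ge\<close>). Both bounds rest on one sum,
  the weighted transfer operator of the density \<open>\<bar>z\<bar>\<^sup>-\<^sup>s\<close> with \<open>s = 1 + \<delta>\<close>,
  \<open>\<Sum>\<^sub>k \<bar>\<phi>\<^sub>k' w\<bar>\<^sup>s \<bar>\<phi>\<^sub>k w\<bar>\<^sup>-\<^sup>s = \<bar>w\<bar>\<^sup>-\<^sup>s \<Sum>\<^sub>k \<bar>\<phi>\<^sub>k w\<bar>\<^sup>-\<^sup>s\<close>: for bounded \<open>w\<close> in \<open>H\<close> the last sum has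
  the order of \<open>L\<^sup>-\<^sup>\<delta> / \<delta>\<close>, as the points \<open>\<phi>\<^sub>k w\<close> are evenly spaced on a vertical line near \<open>Re z = L\<close>.

  Upper bound. With \<open>\<delta> = ln ln L / ln L\<close> one has \<open>L\<^sup>-\<^sup>\<delta> / \<delta> = 1 / ln ln L\<close>, which is small. Charge a
  ball \<open>B(w,r)\<close> centred in \<open>H\<close> with \<open>(r / \<bar>w\<bar>)\<^sup>s\<close>. Taking preimages of a covering by such balls at
  least halves its total charge (\<open>exp_map_contracts_ball_cost\<close>). A non-escaping point of the Julia
  set visits some bounded part of \<open>H\<close> infinitely often, so a Borel-Cantelli argument
  (\<open>cover_content_limsup_null\<close>) shows that these points form a set of content zero, and hence of zero
  \<open>s\<close>-dimensional Hausdorff measure.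

  Lower bound. With \<open>\<delta> = ln ln L / (2 ln L)\<close> one has \<open>L\<^sup>-\<^sup>\<delta> / \<delta> = 2 sqrt (ln L) / ln ln L\<close>, which is
  large, and remains so when only the branches with \<open>L \<le> k \<le> L\<^sup>2\<close> are used. For these \<open>k\<close>, the
  branches map a union of boxes into itself; the points whose orbit stays in the boxes form a compact
  set \<open>K\<close> of bounded orbits. Since \<open>E\<close> is expanding on \<open>K\<close>, no limit function can exist there, so \<open>K\<close>
  lies in the Julia set. That \<open>dim K \<ge> s\<close> follows without measures and without distortion estimates:
  every finite covering of a piece of \<open>K\<close> has \<open>\<Sum> diam\<^sup>s \<ge> 1\<close>, by induction on the number of covering
  sets (\<open>finite_cover_sum_ge_1\<close>). A covering set that meets only one second-level piece is enlarged
  by \<open>E\<close>, and a set that meets several is at least as large as the gaps between these pieces. The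
  factors lost on the way are constants, absorbed because the sum is large. The resulting bound
  \<open>1 + ln ln L / (2 ln L)\<close> exceeds the asserted one by \<open>ln ln ln L / ln L\<close>, which makes the
  inequality strict.
\<close>

section \<open>Covering contents and Hausdorff dimension\<close>

text \<open>
  Coverings are sequences of codes \<open>b\<close> of a type \<open>'b\<close>, each standing for the set \<open>S b\<close> and charged with
  \<open>c b\<close>. Separating the code from the set lets the charge of a ball depend on its centre and radius,
  which the set of its points need not determine in a convenient way; the identity code gives the
  content underlying Hausdorff measure.
\<close>

definition cover_content :: "('b \<Rightarrow> 'a set) \<Rightarrow> ('b \<Rightarrow> ennreal) \<Rightarrow> 'a set \<Rightarrow> ennreal" where
  "cover_content S c A = (INF u\<in>{u :: nat \<Rightarrow> 'b. A \<subseteq> (\<Union>i. S (u i))}. \<Sum>i. c (u i))"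

lemma cover_content_le: "A \<subseteq> (\<Union>i. S (u i)) \<Longrightarrow> cover_content S c A \<le> (\<Sum>i. c (u i))"
  unfolding cover_content_def by (rule INF_lower) simp

lemma cover_content_lessE:
  assumes "cover_content S c A < x"
  obtains u where "A \<subseteq> (\<Union>i. S (u i))" "(\<Sum>i. c (u i)) < x"
  using assms unfolding cover_content_def INF_less_iff by blast

lemma cover_content_mono: "A \<subseteq> B \<Longrightarrow> cover_content S c A \<le> cover_content S c B"
  unfolding cover_content_def by (rule INF_superset_mono) auto

lemma cover_content_UN_le:
  fixes A :: "nat \<Rightarrow> 'a set"
  shows "cover_content S c (\<Union>n. A n) \<le> (\<Sum>n. cover_content S c (A n))"
proof (rule ennreal_le_epsilon)
  fix e :: real
  assume fin: "(\<Sum>n. cover_content S c (A n)) < top" and e: "0 < e"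
  have "\<exists>u. A n \<subseteq> (\<Union>i. S (u i)) \<and> (\<Sum>i. c (u i)) \<le> cover_content S c (A n) + ennreal (e * (1/2) ^ Suc n)"
    for n
  proof -
    have "cover_content S c (A n) \<noteq> top"
      using fin by (metis ennreal_suminf_lessD top.not_eq_extremum)
    then have "cover_content S c (A n) < cover_content S c (A n) + ennreal (e * (1/2) ^ Suc n)"
      using e ennreal_add_left_cancel_less[of "cover_content S c (A n)" 0] by simp
    then show ?thesis
      by (elim cover_content_lessE) (auto intro: less_imp_le)
  qed
  then obtain u where u: "\<And>n. A n \<subseteq> (\<Union>i. S (u n i))"
    "\<And>n. (\<Sum>i. c (u n i)) \<le> cover_content S c (A n) + ennreal (e * (1/2) ^ Suc n)"
    by metis
  have "(\<Union>n. A n) \<subseteq> (\<Union>i. S (case_prod u (prod_decode i)))"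
  proof
    fix x assume "x \<in> (\<Union>n. A n)"
    then obtain n i where "x \<in> S (u n i)" using u(1) by blast
    then show "x \<in> (\<Union>i. S (case_prod u (prod_decode i)))"
      by (intro UN_I[of "prod_encode (n, i)"]) auto
  qed
  then have "cover_content S c (\<Union>n. A n) \<le> (\<Sum>i. c (case_prod u (prod_decode i)))"
    by (rule cover_content_le)
  also have "\<dots> = (\<Sum>n. \<Sum>i. c (u n i))"
    using suminf_ennreal_2dimen[of "\<lambda>n. \<Sum>i. c (u n i)" "\<lambda>p. c (case_prod u p)"] by simp
  also have "\<dots> \<le> (\<Sum>n. cover_content S c (A n) + ennreal (e * (1/2) ^ Suc n))"
    by (intro suminf_le u(2)) auto
  also have "\<dots> = (\<Sum>n. cover_content S c (A n)) + (\<Sum>n. ennreal (e * (1/2) ^ Suc n))"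
    by (subst suminf_add) auto
  also have "(\<Sum>n. ennreal (e * (1/2) ^ Suc n)) = ennreal e"
    using sums_mult[OF power_half_series, of e] e by (intro suminf_ennreal_eq) auto
  finally show "cover_content S c (\<Union>n. A n) \<le> (\<Sum>n. cover_content S c (A n)) + ennreal e" .
qed

lemma cover_content_UN_null:
  fixes A :: "nat \<Rightarrow> 'a set"
  assumes "\<And>n. cover_content S c (A n) = 0"
  shows "cover_content S c (\<Union>n. A n) = 0"
  using cover_content_UN_le[of S c A] assms by simp

lemma cover_content_UN_finite:
  assumes "finite F" "\<And>b. b \<in> F \<Longrightarrow> c b < top" "c b\<^sub>0 = 0" "A \<subseteq> (\<Union>b\<in>F. S b)"
  shows "cover_content S c A < top"
proof -
  obtain g and n :: nat where g: "F = g ` {i. i < n}"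
    using finite_imp_nat_seg_image_inj_on[OF assms(1)] by auto
  have "cover_content S c A \<le> (\<Sum>i. c (if i < n then g i else b\<^sub>0))"
  proof (rule cover_content_le, rule subsetI)
    fix x assume "x \<in> A"
    then obtain i where "i < n" "x \<in> S (g i)" using assms(4) g by auto
    then show "x \<in> (\<Union>i. S (if i < n then g i else b\<^sub>0))" by (intro UN_I[of i]) auto
  qed
  also have "\<dots> = (\<Sum>i<n. c (if i < n then g i else b\<^sub>0))"
    by (rule suminf_finite) (use assms in auto)
  also have "\<dots> < top"
    using assms(2) g by (subst ennreal_sum_less_top) auto
  finally show ?thesis .
qed

text \<open>
  A bound for the preimages of single covering sets passes to arbitrary sets, because the preimage of
  a covering is a covering by preimages.
\<close>

lemma cover_content_vimage:
  assumes "\<And>b. p * cover_content S c {z \<in> H. f z \<in> S b} \<le> c b"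
  shows "p * cover_content S c {z \<in> H. f z \<in> A} \<le> cover_content S c A"
  unfolding cover_content_def[of S c A]
proof (rule INF_greatest)
  fix u :: "nat \<Rightarrow> 'a" assume "u \<in> {u. A \<subseteq> (\<Union>i. S (u i))}"
  then have "cover_content S c {z \<in> H. f z \<in> A} \<le> cover_content S c (\<Union>i. {z \<in> H. f z \<in> S (u i)})"
    by (intro cover_content_mono) auto
  also have "\<dots> \<le> (\<Sum>i. cover_content S c {z \<in> H. f z \<in> S (u i)})"
    by (rule cover_content_UN_le)
  finally have "p * cover_content S c {z \<in> H. f z \<in> A} \<le> p * (\<Sum>i. cover_content S c {z \<in> H. f z \<in> S (u i)})"
    by (rule mult_left_mono) simp
  also have "\<dots> = (\<Sum>i. p * cover_content S c {z \<in> H. f z \<in> S (u i)})" by simp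
  also have "\<dots> \<le> (\<Sum>i. c (u i))" by (intro suminf_le assms) auto
  finally show "p * cover_content S c {z \<in> H. f z \<in> A} \<le> (\<Sum>i. c (u i))" .
qed

text \<open>
  A Borel-Cantelli lemma. Each preimage under \<open>f\<close> halves the content, so the \<open>n\<close>-th preimages of \<open>A\<close>
  have a convergent sum of contents, and the points that visit \<open>A\<close> infinitely often lie in
  every tail of the union.
\<close>

lemma cover_content_limsup_null:
  fixes f :: "'a \<Rightarrow> 'a"
  assumes contr: "\<And>b. 2 * cover_content S c {z \<in> H. f z \<in> S b} \<le> c b"
      and fin: "cover_content S c A < top"
  shows "cover_content S c {z. (\<forall>n. (f ^^ n) z \<in> H) \<and> (\<exists>\<^sub>F n in sequentially. (f ^^ n) z \<in> A)} = 0"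
    (is "cover_content S c ?J = 0")
proof -
  \<comment> \<open>\<open>B n\<close>: the points of \<open>H\<close> that reach \<open>A\<close> after \<open>n\<close> steps within \<open>H\<close>\<close>
  define B where "B n = ((\<lambda>B. {z \<in> H. f z \<in> B}) ^^ n) A" for n
  obtain a where a: "cover_content S c A = ennreal a" "0 \<le> a"
    using fin by (cases "cover_content S c A") auto
  have B: "cover_content S c (B n) \<le> ennreal (a * (1/2) ^ n)" for n
  proof (induction n)
    case 0 then show ?case using a by (simp add: B_def)
  next
    case (Suc n)
    have "2 * cover_content S c (B (Suc n)) \<le> cover_content S c (B n)"
      using cover_content_vimage[OF contr, of "B n"] by (simp add: B_def)
    also have "\<dots> \<le> ennreal (a * (1/2) ^ n)" by (rule Suc)
    also have "\<dots> = 2 * ennreal (a * (1/2) ^ Suc n)"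
      using a by (simp add: ennreal_mult[symmetric] flip: ennreal_numeral)
    finally show ?case
      by (subst (asm) ennreal_mult_le_mult_iff) auto
  qed
  have mem: "z \<in> B n" if "(f ^^ n) z \<in> A" "\<forall>n. (f ^^ n) z \<in> H" for n z
    using that
  proof (induction n arbitrary: z)
    case 0 then show ?case by (simp add: B_def)
  next
    case (Suc n)
    have "f z \<in> B n"
    proof (rule Suc.IH)
      show "(f ^^ n) (f z) \<in> A" using Suc.prems(1) by (simp add: funpow_swap1)
      show "\<forall>n. (f ^^ n) (f z) \<in> H"
        using Suc.prems(2) by (metis funpow_swap1 funpow.simps(2) o_apply)
    qed
    moreover have "z \<in> H" using Suc.prems(2) by (metis funpow_0)
    ultimately show ?case by (simp add: B_def)
  qed
  have le: "cover_content S c ?J \<le> ennreal (2 * a * (1/2) ^ N)" for N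
  proof -
    have "?J \<subseteq> (\<Union>n. B (n + N))"
    proof
      fix z assume z: "z \<in> ?J"
      then obtain n where "n \<ge> N" "(f ^^ n) z \<in> A"
        by (auto simp: frequently_sequentially)
      then have "z \<in> B ((n - N) + N)" using z by (intro mem) auto
      then show "z \<in> (\<Union>n. B (n + N))" by blast
    qed
    then have "cover_content S c ?J \<le> (\<Sum>n. cover_content S c (B (n + N)))"
      by (rule order_trans[OF cover_content_mono cover_content_UN_le])
    also have "\<dots> \<le> (\<Sum>n. ennreal (a * (1/2) ^ (n + N)))"
      by (intro suminf_le B) auto
    also have "\<dots> = ennreal (2 * a * (1/2) ^ N)"
    proof (rule suminf_ennreal_eq)
      have "(\<lambda>n. (a * (1/2) ^ N) * (1/2) ^ n) sums ((a * (1/2) ^ N) * (1 / (1 - 1/2)))"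
        by (intro sums_mult geometric_sums) auto
      then show "(\<lambda>n. a * (1/2) ^ (n + N)) sums (2 * a * (1/2) ^ N)"
        by (simp add: power_add algebra_simps)
    qed (use a in auto)
    finally show ?thesis .
  qed
  have "(\<lambda>N. ennreal (2 * a * (1/2) ^ N)) \<longlonglongrightarrow> ennreal (2 * a * 0)"
    by (intro tendsto_ennrealI tendsto_intros LIMSEQ_power_zero) auto
  then have "cover_content S c ?J \<le> ennreal (2 * a * 0)"
    by (rule LIMSEQ_le_const) (use le in auto)
  then show ?thesis by simp
qed

definition hausdorff_cost :: "real \<Rightarrow> 'a::metric_space set \<Rightarrow> ennreal" where
  "hausdorff_cost s U = (if bounded U then diam_power s U else top)"

text \<open>
  No restriction on the diameters is needed to detect measure zero: for \<open>s > 0\<close> a covering with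
  small \<open>\<Sum> diam\<^sup>s\<close> consists of sets of small diameter.
\<close>

lemma hausdorff_measure_null:
  assumes s: "0 < s" and null: "cover_content (\<lambda>U. U) (hausdorff_cost s) A = 0"
  shows "hausdorff_measure s A = 0"
proof -
  have "hausdorff_premeasure s \<delta> A \<le> 0 + ennreal e" if \<delta>: "0 < \<delta>" and e: "0 < e" for \<delta> e
  proof -
    \<comment> \<open>a total below \<open>\<delta>\<^sup>s\<close> forces every single diameter below \<open>\<delta>\<close>\<close>
    define x where "x = min e (\<delta> powr s)"
    have x: "0 < x" using \<delta> e by (auto simp: x_def)
    then have "cover_content (\<lambda>U. U) (hausdorff_cost s) A < ennreal x" using null by simp
    then obtain U where U: "A \<subseteq> (\<Union>i. U i)" "(\<Sum>i. hausdorff_cost s (U i)) < ennreal x"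
      by (rule cover_content_lessE)
    have less: "hausdorff_cost s (U i) < ennreal x" for i
      using ennreal_suminf_lessD[OF U(2)] .
    have bd: "bounded (U i)" for i
      using less[of i] by (auto simp: hausdorff_cost_def split: if_splits)
    have "diameter (U i) \<le> \<delta>" for i
    proof (cases "U i = {}")
      case True then show ?thesis using \<delta> by simp
    next
      case False
      then have "ennreal (diameter (U i) powr s) < ennreal x"
        using less[of i] s bd by (simp add: hausdorff_cost_def diam_power_def)
      then have "diameter (U i) powr s < \<delta> powr s"
        by (simp add: ennreal_less_iff x_def)
      then show ?thesis
        using s \<delta> powr_mono2[of s \<delta> "diameter (U i)"] by linarith
    qed
    then have "hausdorff_premeasure s \<delta> A \<le> (\<Sum>i. diam_power s (U i))"
      unfolding hausdorff_premeasure_def by (intro INF_lower) (use U(1) bd in auto)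
    also have "\<dots> = (\<Sum>i. hausdorff_cost s (U i))" using bd by (simp add: hausdorff_cost_def)
    also have "\<dots> \<le> ennreal e" using U(2) by (auto simp: x_def min_def split: if_splits intro: less_imp_le order.trans[OF less_imp_le ennreal_leI])
    finally show ?thesis by simp
  qed
  then have "hausdorff_premeasure s \<delta> A \<le> 0" if "0 < \<delta>" for \<delta>
    by (rule ennreal_le_epsilon) (rule that)
  then have "hausdorff_measure s A \<le> 0"
    unfolding hausdorff_measure_def by (intro SUP_least) simp
  then show ?thesis by simp
qed

lemma hausdorff_measure_mono: "A \<subseteq> B \<Longrightarrow> hausdorff_measure s A \<le> hausdorff_measure s B"
  unfolding hausdorff_measure_def hausdorff_premeasure_def
  by (intro SUP_mono' INF_superset_mono) auto

lemma hausdorff_dim_mono: "A \<subseteq> B \<Longrightarrow> hausdorff_dim A \<le> hausdorff_dim B"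
  unfolding hausdorff_dim_def
  by (intro Inf_superset_mono) (auto, metis hausdorff_measure_mono le_zero_eq)

lemma hausdorff_dim_le: "0 \<le> s \<Longrightarrow> hausdorff_measure s A = 0 \<Longrightarrow> hausdorff_dim A \<le> ereal s"
  unfolding hausdorff_dim_def by (intro Inf_lower) auto

text \<open>
  The exponent changes from \<open>t\<close> to the larger \<open>s\<close> because \<open>x\<^sup>s \<le> x\<^sup>t\<close> for \<open>x \<le> 1\<close>; the loss
  \<open>\<epsilon>\<close> comes from the continuity of \<open>x\<^sup>s\<close>.
\<close>

lemma open_thickening:
  fixes U :: "'a::metric_space set"
  assumes U: "bounded U" "diameter U \<le> 1" and t: "0 \<le> t" "t \<le> s" and s: "0 < s" and \<epsilon>: "0 < \<epsilon>"
  shows "\<exists>V. open V \<and> bounded V \<and> U \<subseteq> V \<and> ennreal (diameter V powr s) \<le> diam_power t U + ennreal \<epsilon>"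
proof (cases "U = {}")
  case True
  then show ?thesis by (intro exI[of _ "{}"]) auto
next
  case False
  let ?d = "diameter U"
  have d0: "0 \<le> ?d" using U(1) by (rule diameter_ge_0)
  have "continuous_on {0..} (\<lambda>x::real. x powr s)"
    using s by (intro continuous_on_powr') (auto intro: continuous_intros)
  then obtain \<eta> where \<eta>: "0 < \<eta>" "\<And>x. 0 \<le> x \<Longrightarrow> dist x ?d < \<eta> \<Longrightarrow> dist (x powr s) (?d powr s) < \<epsilon>"
    using d0 \<epsilon> unfolding continuous_on_iff by (metis atLeast_iff)
  define V where "V = (\<Union>x\<in>U. ball x (\<eta> / 3))"
  have dV: "dist x y \<le> ?d + 2 * (\<eta> / 3)" if xy: "x \<in> V" "y \<in> V" for x y
  proof -
    obtain x' y' where *: "x' \<in> U" "y' \<in> U" "dist x' x < \<eta> / 3" "dist y' y < \<eta> / 3"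
      using xy by (auto simp: V_def)
    have "dist x y \<le> dist x' x + dist x' y' + dist y' y"
      using dist_triangle[of x y x'] dist_triangle[of x' y y'] by (simp add: dist_commute)
    then show ?thesis using * diameter_bounded_bound[OF U(1) *(1,2)] by linarith
  qed
  obtain x\<^sub>0 where x0: "x\<^sub>0 \<in> U" using False by blast
  then have "x\<^sub>0 \<in> V" using \<eta>(1) by (auto simp: V_def intro!: bexI[of _ x\<^sub>0])
  then have bV: "bounded V" using dV unfolding bounded_def by blast
  have "diameter V \<le> ?d + 2 * (\<eta> / 3)"
    using \<open>x\<^sub>0 \<in> V\<close> dV by (subst diameter_def) (auto intro!: cSUP_least)
  then have "diameter V powr s \<le> (?d + 2 * (\<eta> / 3)) powr s"
    using s bV by (intro powr_mono2 diameter_ge_0) auto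
  also have "\<dots> < ?d powr s + \<epsilon>"
    using \<eta>(2)[of "?d + 2 * (\<eta> / 3)"] \<eta>(1) d0 by (auto simp: dist_real_def)
  finally have "ennreal (diameter V powr s) \<le> ennreal (?d powr s) + ennreal \<epsilon>"
    using \<epsilon> by (simp add: ennreal_leI flip: ennreal_plus)
  also have "ennreal (?d powr s) \<le> diam_power t U"
  proof (cases "t = 0")
    case True
    then show ?thesis using False d0 U(2) s by (auto simp: diam_power_def intro!: powr_le1)
  next
    case neq: False
    have "?d powr s \<le> ?d powr t"
      using d0 U(2) t by (intro powr_mono') auto
    then show ?thesis using False neq by (auto simp: diam_power_def intro!: ennreal_leI)
  qed
  finally have "ennreal (diameter V powr s) \<le> diam_power t U + ennreal \<epsilon>" by simp
  moreover have "open V" by (auto simp: V_def)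
  moreover have "U \<subseteq> V" unfolding V_def using \<eta>(1) by force
  ultimately show ?thesis using bV by blast
qed

text \<open>
  For compact sets a lower bound for finite coverings suffices: a countable covering
  can be thickened to an open one at little cost, and the open one has a finite subcovering.
\<close>

lemma compact_hausdorff_dim_ge:
  fixes K :: "'a::metric_space set"
  assumes K: "compact K" and s: "0 < s"
    and cover: "\<And>(I::nat set) U. finite I \<Longrightarrow> (\<And>i. i \<in> I \<Longrightarrow> bounded (U i)) \<Longrightarrow> K \<subseteq> (\<Union>i\<in>I. U i)
      \<Longrightarrow> 1 \<le> (\<Sum>i\<in>I. diameter (U i) powr s)"
  shows "ereal s \<le> hausdorff_dim K"
  unfolding hausdorff_dim_def
proof (rule Inf_greatest, clarify)
  fix t assume t: "0 \<le> t" and null: "hausdorff_measure t K = 0"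
  show "ereal s \<le> ereal t"
  proof (rule ccontr)
    assume "\<not> ?thesis"
    then have ts: "t \<le> s" by simp
    have "hausdorff_premeasure t 1 K \<le> hausdorff_measure t K"
      unfolding hausdorff_measure_def by (intro SUP_upper) simp
    also have "\<dots> < ennreal (1 / 2)" unfolding null ennreal_less_zero_iff by simp
    finally have "hausdorff_premeasure t 1 K < ennreal (1 / 2)" .
    then obtain U where U: "K \<subseteq> (\<Union>i. U i)" "\<And>i. bounded (U i)" "\<And>i. diameter (U i) \<le> 1"
        "(\<Sum>i::nat. diam_power t (U i)) < ennreal (1 / 2)"
      unfolding hausdorff_premeasure_def INF_less_iff by blast
    \<comment> \<open>the thickenings cost at most \<open>1/2\<close> altogether, on top of a covering with sum below \<open>1/2\<close>\<close>
    have "\<exists>V. open V \<and> bounded V \<and> U i \<subseteq> V \<and>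
        ennreal (diameter V powr s) \<le> diam_power t (U i) + ennreal ((1/2) * (1/2) ^ Suc i)" for i
      using U t ts s by (intro open_thickening) auto
    then obtain V where V: "\<And>i. open (V i)" "\<And>i. bounded (V i)" "\<And>i. U i \<subseteq> V i"
      "\<And>i. ennreal (diameter (V i) powr s) \<le> diam_power t (U i) + ennreal ((1/2) * (1/2) ^ Suc i)"
      by metis
    have "K \<subseteq> (\<Union>i\<in>UNIV. V i)" using U(1) V(3) by blast
    then obtain I where I: "finite I" "K \<subseteq> (\<Union>i\<in>I. V i)"
      using compactE_image[OF K, of UNIV V] V(1) by auto
    have "ennreal 1 \<le> ennreal (\<Sum>i\<in>I. diameter (V i) powr s)"
      using cover[OF I(1) _ I(2)] V(2) by (intro ennreal_leI) auto
    also have "\<dots> = (\<Sum>i\<in>I. ennreal (diameter (V i) powr s))" by (subst sum_ennreal) auto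
    also have "\<dots> \<le> (\<Sum>i\<in>I. diam_power t (U i) + ennreal ((1/2) * (1/2) ^ Suc i))"
      by (intro sum_mono V(4))
    also have "\<dots> \<le> (\<Sum>i. diam_power t (U i) + ennreal ((1/2) * (1/2) ^ Suc i))"
      using I(1) by (intro sum_le_suminf) auto
    also have "\<dots> = (\<Sum>i. diam_power t (U i)) + (\<Sum>i. ennreal ((1/2) * (1/2) ^ Suc i))"
      by (subst suminf_add) auto
    also have "(\<Sum>i. ennreal ((1/2) * (1/2) ^ Suc i)) = ennreal (1 / 2)"
      using sums_mult[OF power_half_series, of "1/2"] by (intro suminf_ennreal_eq) auto
    also have "(\<Sum>i. diam_power t (U i)) + ennreal (1 / 2) < ennreal (1 / 2) + ennreal (1 / 2)"
      using U(4) by (metis add.commute ennreal_add_left_cancel_less ennreal_neq_top infinity_ennreal_def)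
    also have "\<dots> = ennreal 1" by (subst ennreal_plus[symmetric]) auto
    finally show False by simp
  qed
qed

section \<open>Orbits in the Julia set of the exponential map\<close>

lemma funpow_exp_holomorphic: "(exp_map c ^^ n) holomorphic_on D"
proof (induction n)
  case 0 then show ?case by (simp add: id_def)
next
  case (Suc n)
  then show ?case unfolding funpow.simps o_def exp_map_def[abs_def]
    by (intro holomorphic_intros)
qed

lemma exp_map_exp: "exp_map (exp (-L)) z = exp (z - of_real L)"
  by (simp add: exp_map_def exp_diff exp_minus field_simps exp_of_real)

lemma norm_exp_map: "norm (exp_map (exp (-L)) z) = exp (Re z - L)"
  by (simp add: exp_map_exp)

lemma exp_map_deriv:
  "((exp_map c) has_field_derivative exp_map c z) (at z within X)"
  unfolding exp_map_def[abs_def] by (auto intro!: derivative_eq_intros)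

text \<open>
  An orbit that enters \<open>Re z < L\<close> falls into the unit disc and stays there, together with the orbits of
  all nearby points; by Montel's theorem the iterates are normal near such a point.
\<close>

lemma julia_orbit_ge:
  assumes L: "1 \<le> L" and z: "z \<in> julia_set (exp_map (exp (-L)))"
  shows "L \<le> Re ((exp_map (exp (-L)) ^^ n) z)"
proof (rule ccontr)
  let ?f = "exp_map (exp (-L))"
  assume neg: "\<not> L \<le> Re ((?f ^^ n) z)"
  define U where "U = {w. Re ((?f ^^ n) w) < L}"
  have "open U"
    unfolding U_def
    using holomorphic_on_imp_continuous_on[OF funpow_exp_holomorphic[where c = "exp (-L)" and n = n and D = UNIV]]
    by (intro open_Collect_less continuous_intros) (auto simp: continuous_on_eq_continuous_at)
  then obtain e where e: "0 < e" "ball z e \<subseteq> U" "z \<in> U"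
    using neg open_contains_ball_eq[of U z] by (auto simp: U_def)
  let ?D = "ball z e"
  have small: "norm ((?f ^^ (Suc n + m)) w) < 1" if "w \<in> ?D" for w m
  proof (induction m)
    case 0
    show ?case using that e by (auto simp: norm_exp_map U_def)
  next
    case (Suc m)
    have "Re ((?f ^^ (Suc n + m)) w) < L"
      using Suc L complex_Re_le_cmod[of "(?f ^^ (Suc n + m)) w"] by linarith
    then show ?case by (simp add: norm_exp_map)
  qed
  have bnd: "\<exists>B. \<forall>h\<in>range (\<lambda>n. ?f ^^ n). \<forall>w\<in>K. norm (h w) \<le> B" if "compact K" "K \<subseteq> ?D" for K
  proof -
    have "\<exists>B. \<forall>w\<in>K. norm ((?f ^^ m) w) \<le> B" for m
    proof -
      have "compact ((?f ^^ m) ` K)"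
        by (intro compact_continuous_image holomorphic_on_imp_continuous_on funpow_exp_holomorphic that(1))
      from compact_imp_bounded[OF this] show ?thesis by (simp add: bounded_iff)
    qed
    then obtain B where B: "\<And>m w. w \<in> K \<Longrightarrow> norm ((?f ^^ m) w) \<le> B m" by metis
    have "norm ((?f ^^ m) w) \<le> max 1 (Max (B ` {..n}))" if "w \<in> K" for m w
    proof (cases "m \<le> n")
      case True
      then have "B m \<le> Max (B ` {..n})" by (intro Max_ge) auto
      then show ?thesis using B[OF that, of m] by linarith
    next
      case False
      then obtain k where "m = Suc n + k" using less_imp_Suc_add[of n m] by auto
      then show ?thesis using small[of w k] that \<open>K \<subseteq> ?D\<close> by fastforce
    qed
    then show ?thesis by blast
  qed
  have "normal_family_on ?D (range (\<lambda>n. ?f ^^ n))"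
    unfolding normal_family_on_def
  proof (intro conjI ballI allI impI)
    show "h holomorphic_on ?D" if "h \<in> range (\<lambda>n. ?f ^^ n)" for h
      using that funpow_exp_holomorphic by auto
    fix F :: "nat \<Rightarrow> complex \<Rightarrow> complex" assume F: "range F \<subseteq> range (\<lambda>n. ?f ^^ n)"
    obtain g r where "g holomorphic_on ?D" "strict_mono (r :: nat \<Rightarrow> nat)"
        "\<And>K. \<lbrakk>compact K; K \<subseteq> ?D\<rbrakk> \<Longrightarrow> uniform_limit K (F \<circ> r) g sequentially"
    proof (rule Montel[of ?D "range (\<lambda>n. ?f ^^ n)" F])
      show "h holomorphic_on ?D" if "h \<in> range (\<lambda>n. ?f ^^ n)" for h
        using that funpow_exp_holomorphic by auto
    qed (use bnd F in auto)
    then show "\<exists>r. strict_mono r \<and> ((\<exists>g. g holomorphic_on ?D \<and> (\<forall>K. compact K \<and> K \<subseteq> ?D \<longrightarrow>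
        uniform_limit K (F \<circ> r) g sequentially)) \<or> (\<forall>K. compact K \<and> K \<subseteq> ?D \<longrightarrow>
              (\<forall>B. \<forall>\<^sub>F n in sequentially. \<forall>z\<in>K. B < norm (F (r n) z))))"
      by blast
  qed
  then have "z \<in> fatou_set ?f"
    unfolding fatou_set_def using e by (auto intro!: exI[of _ ?D])
  then show False using z by (simp add: julia_set_def)
qed

text \<open>
  Since \<open>E' = E\<close>, the derivative of the \<open>n\<close>-th iterate is the product of the first \<open>n\<close> images and
  so at least \<open>2\<^sup>n\<close> in modulus. By Cauchy's inequality this excludes a holomorphic limit function, and
  boundedness of the orbit excludes the limit \<open>\<infinity>\<close>.
\<close>

lemma expanding_bounded_orbit_in_julia_bd:
  assumes L: "2 \<le> L"
      and orbit: "\<And>n. L \<le> Re ((exp_map (exp (-L)) ^^ n) z)"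
      and bdd: "bounded (range (\<lambda>n. (exp_map (exp (-L)) ^^ n) z))"
  shows "z \<in> julia_bd (exp_map (exp (-L)))"
proof -
  let ?f = "exp_map (exp (-L))"
  have der: "\<exists>d. ((?f ^^ n) has_field_derivative d) (at z) \<and> 2 ^ n \<le> norm d" for n
  proof (induction n)
    case 0 show ?case by (rule exI[of _ 1]) (auto simp: id_def)
  next
    case (Suc n)
    then obtain d where d: "((?f ^^ n) has_field_derivative d) (at z)" "2 ^ n \<le> norm d" by blast
    have "((?f ^^ Suc n) has_field_derivative (?f ((?f ^^ n) z)) * d) (at z)"
      using DERIV_chain[OF exp_map_deriv d(1)] by (simp add: o_def)
    moreover have "2 * 2 ^ n \<le> norm (?f ((?f ^^ n) z)) * norm d"
      using order_trans[OF order_trans[OF L orbit[of "Suc n"]] complex_Re_le_cmod] d(2)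
      by (intro mult_mono) auto
    ultimately show ?case by (metis norm_mult power_Suc)
  qed
  have "z \<notin> fatou_set ?f"
  proof
    assume "z \<in> fatou_set ?f"
    then obtain D where D: "open D" "z \<in> D" and N: "normal_family_on D (range (\<lambda>n. ?f ^^ n))"
      unfolding fatou_set_def by blast
    from N[unfolded normal_family_on_def, THEN conjunct2, rule_format, of "\<lambda>n. ?f ^^ n"]
    obtain r where r: "strict_mono (r :: nat \<Rightarrow> nat)" and
      alt: "(\<exists>g. g holomorphic_on D \<and> (\<forall>K. compact K \<and> K \<subseteq> D \<longrightarrow>
          uniform_limit K ((\<lambda>n. ?f ^^ n) \<circ> r) g sequentially)) \<or>
         (\<forall>K. compact K \<and> K \<subseteq> D \<longrightarrow> (\<forall>B. \<forall>\<^sub>F n in sequentially. \<forall>z\<in>K. B < norm ((?f ^^ r n) z)))"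
      by blast
    from alt show False
    proof
      assume "\<forall>K. compact K \<and> K \<subseteq> D \<longrightarrow> (\<forall>B. \<forall>\<^sub>F n in sequentially. \<forall>z\<in>K. B < norm ((?f ^^ r n) z))"
      from this[rule_format, of "{z}"] D(2)
      have ev: "\<forall>\<^sub>F n in sequentially. B < norm ((?f ^^ r n) z)" for B by simp
      obtain B where B: "\<And>n. norm ((?f ^^ n) z) \<le> B" using bdd by (auto simp: bounded_iff)
      have "\<forall>\<^sub>F n in sequentially. False"
        using ev[of B] by (rule eventually_mono) (use B in \<open>simp add: not_less[symmetric]\<close>)
      then show False by simp
    next
      assume "\<exists>g. g holomorphic_on D \<and> (\<forall>K. compact K \<and> K \<subseteq> D \<longrightarrow>
          uniform_limit K ((\<lambda>n. ?f ^^ n) \<circ> r) g sequentially)"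
      then obtain g where g: "g holomorphic_on D"
        "\<And>K. compact K \<Longrightarrow> K \<subseteq> D \<Longrightarrow> uniform_limit K ((\<lambda>n. ?f ^^ n) \<circ> r) g sequentially" by blast
      obtain e where e: "0 < e" "cball z e \<subseteq> D" using D open_contains_cball by blast
      have "compact (g ` cball z e)"
        using g(1) e(2) by (intro compact_continuous_image holomorphic_on_imp_continuous_on)
          (auto intro: holomorphic_on_subset)
      from compact_imp_bounded[OF this] obtain B where B: "\<And>w. w \<in> cball z e \<Longrightarrow> norm (g w) \<le> B"
        unfolding bounded_iff by blast
      have "\<forall>\<^sub>F n in sequentially. \<forall>w\<in>cball z e. dist ((?f ^^ r n) w) (g w) < 1"
        using g(2)[of "cball z e"] e(2) by (auto simp: uniform_limit_iff)
      moreover have "filterlim (\<lambda>n. (2::real) ^ n) at_top sequentially" by real_asymp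
      then have "\<forall>\<^sub>F n in sequentially. (B + 1) / e < 2 ^ n"
        by (simp add: filterlim_at_top_dense)
      ultimately have "\<forall>\<^sub>F n in sequentially. False"
      proof eventually_elim
        case (elim n)
        have bd: "norm ((?f ^^ r n) w) \<le> B + 1" if "w \<in> cball z e" for w
          using elim(1)[rule_format, OF that] B[OF that] norm_triangle_ineq2[of "(?f ^^ r n) w" "g w"]
          by (simp add: dist_norm)
        obtain d where d: "((?f ^^ r n) has_field_derivative d) (at z)" "2 ^ r n \<le> norm d"
          using der by blast
        have "norm ((deriv ^^ 1) (?f ^^ r n) z) \<le> fact 1 * (B + 1) / e ^ 1"
          using e bd by (intro Cauchy_inequality funpow_exp_holomorphic
              holomorphic_on_imp_continuous_on) (auto simp: dist_norm)
        then have "norm d \<le> (B + 1) / e" using DERIV_imp_deriv[OF d(1)] by simp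
        moreover have "(2::real) ^ n \<le> 2 ^ r n"
          using seq_suble[OF r, of n] by (intro power_increasing) auto
        ultimately show False using d(2) elim(2) by linarith
      qed
      then show False by simp
    qed
  qed
  then show ?thesis using bdd by (simp add: julia_bd_def julia_set_def)
qed

lemma julia_bd_subset_julia_r: "julia_bd f \<subseteq> julia_r f"
proof
  fix z assume z: "z \<in> julia_bd f"
  then obtain B where B: "\<And>n. norm ((f ^^ n) z) \<le> B"
    by (auto simp: julia_bd_def bounded_iff)
  have "\<not> filterlim (\<lambda>n. (f ^^ n) z) at_infinity sequentially"
  proof
    assume "filterlim (\<lambda>n. (f ^^ n) z) at_infinity sequentially"
    then have "\<forall>\<^sub>F n in sequentially. B < norm ((f ^^ n) z)"
      by (simp add: filterlim_at_infinity_conv_norm_at_top filterlim_at_top_dense)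
    then have "\<forall>\<^sub>F n in sequentially. False"
      by (rule eventually_mono) (use B in \<open>simp add: not_less[symmetric]\<close>)
    then show False by simp
  qed
  then show "z \<in> julia_r f" using z by (simp add: julia_bd_def julia_r_def escaping_set_def)
qed

section \<open>Inverse branches\<close>

definition branch :: "real \<Rightarrow> int \<Rightarrow> complex \<Rightarrow> complex" where
  "branch L k w = Ln w + of_real L + 2 * pi * of_int k * \<i>"

lemma exp_map_branch: "w \<noteq> 0 \<Longrightarrow> exp_map (exp (-L)) (branch L k w) = w"
  using exp_integer_2pi[of "of_int k"]
  by (simp add: exp_map_exp branch_def exp_add exp_Ln mult_ac)

lemma branch_Re: "w \<noteq> 0 \<Longrightarrow> Re (branch L k w) = L + ln (norm w)"
  by (simp add: branch_def)

lemma branch_Im: "0 < Re w \<Longrightarrow> \<bar>Im (branch L k w) - 2 * pi * of_int k\<bar> \<le> pi / 2"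
  using Re_Ln_pos_lt_imp[of w] Re_Ln_pos_lt[of w] by (cases "w = 0") (auto simp: branch_def)

lemma exp_map_eq_branch:
  assumes "exp_map (exp (-L)) z = v" "v \<noteq> 0"
  obtains k where "z = branch L k v"
proof -
  have "exp (z - of_real L) = exp (Ln v)" using assms by (simp add: exp_map_exp)
  then obtain n :: int where "z - of_real L = Ln v + (of_int (2 * n) * pi) * \<i>"
    unfolding exp_eq by auto
  then have "z = branch L n v" by (simp add: branch_def algebra_simps)
  then show ?thesis by (rule that)
qed

text \<open>
  The derivative of the logarithm is \<open>1 / x\<close>, and \<open>\<bar>x\<bar> \<ge> \<bar>w\<bar> / 2\<close> on the ball. The factor \<open>2\<close> replaces
  a distortion estimate: it is lost in every step, but the gain in the transfer sum is larger.
\<close>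

lemma branch_dist:
  assumes w: "2 \<le> Re w" and r: "r \<le> 1" and v: "v \<in> ball w r"
  shows "dist (branch L k w) (branch L k v) < 2 * r / norm w"
proof -
  have nw: "2 \<le> norm w" using w complex_Re_le_cmod[of w] by linarith
  have "norm (Ln v - Ln w) \<le> 2 / norm w * norm (v - w)"
  proof (rule field_differentiable_bound[of "ball w r" _ inverse])
    fix x assume x: "x \<in> ball w r"
    then have d: "norm (w - x) < 1" using r by (simp add: dist_norm)
    have "Re w - Re x \<le> norm (w - x)" using complex_Re_le_cmod[of "w - x"] by simp
    then have "x \<notin> \<real>\<^sub>\<le>\<^sub>0" using d w by (auto simp: complex_nonpos_Reals_iff)
    then show "(Ln has_field_derivative inverse x) (at x within ball w r)"
      by (rule has_field_derivative_Ln[THEN has_field_derivative_at_within])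
    have "norm w / 2 \<le> norm x" using d nw norm_triangle_ineq2[of w x] by linarith
    then show "norm (inverse x) \<le> 2 / norm w"
      using nw le_imp_inverse_le[of "norm w / 2" "norm x"] by (cases "w = 0") (auto simp: norm_inverse)
  qed (use v in \<open>auto intro: le_less_trans[OF zero_le_dist]\<close>)
  also have "\<dots> < 2 / norm w * r"
    using v nw by (intro mult_strict_left_mono) (auto simp: dist_norm norm_minus_commute)
  finally show ?thesis by (simp add: branch_def dist_norm norm_minus_commute algebra_simps)
qed

text \<open>
  The integers are enumerated by \<open>int_decode\<close> so that the sum over all branches becomes a series over
  the naturals, and \<open>\<bar>int_decode n\<bar>\<close> is roughly \<open>n / 2\<close>.
\<close>

lemma branch_norm_ge:
  assumes L: "1 \<le> L" and w: "1 \<le> Re w"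
  shows "(L + real n) / 8 \<le> norm (branch L (int_decode n) w)"
proof -
  let ?k = "int_decode n" let ?z = "branch L ?k w"
  have n: "real n \<le> 2 * \<bar>real_of_int ?k\<bar> + 1"
  proof -
    have "int (int_encode ?k) \<le> 2 * \<bar>?k\<bar> + 1"
      unfolding int_encode_def sum_encode_def by auto
    then show ?thesis by simp
  qed
  have "1 \<le> norm w" using w complex_Re_le_cmod[of w] by linarith
  then have "L \<le> Re ?z" using w by (subst branch_Re) auto
  then have 1: "L \<le> norm ?z" using complex_Re_le_cmod[of ?z] by linarith
  have 2: "\<bar>real_of_int ?k\<bar> \<le> norm ?z"
  proof (cases "?k = 0")
    case False
    then have k: "1 \<le> \<bar>real_of_int ?k\<bar>" by linarith
    have "2 * pi * \<bar>real_of_int ?k\<bar> - pi / 2 \<le> \<bar>Im ?z\<bar>"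
      using branch_Im[of w L ?k] w by (cases "0 \<le> ?k") (auto simp: abs_real_def split: if_splits)
    moreover have "pi \<le> pi * \<bar>real_of_int ?k\<bar>" "3 * \<bar>real_of_int ?k\<bar> \<le> pi * \<bar>real_of_int ?k\<bar>"
      using k pi_gt3 by (auto intro!: mult_right_mono)
    ultimately show ?thesis using abs_Im_le_cmod[of ?z] pi_gt3 by linarith
  qed simp
  show ?thesis using n 1 2 L by simp
qed

section \<open>Sums of powers\<close>

text \<open>
  Mean value theorem for \<open>x\<^sup>-\<^sup>\<delta>\<close>. These two inequalities serve as the integral test, in both directions.
\<close>

lemma powr_telescope:
  fixes x \<delta> :: real
  assumes x: "0 < x" and \<delta>: "0 < \<delta>"
  shows "(x powr -\<delta> - (x + 1) powr -\<delta>) / \<delta> \<le> x powr -(1 + \<delta>)"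
    and "(x + 1) powr -(1 + \<delta>) \<le> (x powr -\<delta> - (x + 1) powr -\<delta>) / \<delta>"
proof -
  have "\<exists>\<xi>>x. \<xi> < x + 1 \<and> (x + 1) powr -\<delta> - x powr -\<delta> = (x + 1 - x) * (-\<delta> * \<xi> powr (-\<delta> - 1))"
    using x by (intro MVT2) (auto intro!: derivative_eq_intros simp: field_simps powr_diff)
  then obtain \<xi> where \<xi>: "x < \<xi>" "\<xi> < x + 1"
    "(x + 1) powr -\<delta> - x powr -\<delta> = - \<delta> * \<xi> powr (-\<delta> - 1)" by auto
  then have eq: "(x powr -\<delta> - (x + 1) powr -\<delta>) / \<delta> = \<xi> powr -(1 + \<delta>)"
  proof -
    have e: "- \<delta> - 1 = -(1 + \<delta>)" by simp
    have "x powr -\<delta> - (x + 1) powr -\<delta> = \<xi> powr -(1 + \<delta>) * \<delta>"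
      using \<xi>(3)[unfolded e] by (simp only: mult.commute mult_minus_left mult_minus_right)
    then show ?thesis using \<delta> by simp
  qed
  show "(x powr -\<delta> - (x + 1) powr -\<delta>) / \<delta> \<le> x powr -(1 + \<delta>)"
    unfolding eq using \<xi> x \<delta> by (intro powr_mono2') auto
  show "(x + 1) powr -(1 + \<delta>) \<le> (x powr -\<delta> - (x + 1) powr -\<delta>) / \<delta>"
    unfolding eq using \<xi> x \<delta> by (intro powr_mono2') auto
qed

lemma suminf_powr_le:
  fixes L \<delta> :: real
  assumes L: "0 < L" and \<delta>: "0 < \<delta>"
  shows "(\<Sum>n. ennreal ((L + real n) powr -(1 + \<delta>))) \<le> ennreal (L powr -(1 + \<delta>) + L powr -\<delta> / \<delta>)"
proof (rule suminf_le_const)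
  fix n
  have "(\<Sum>i<Suc n. (L + real i) powr -(1 + \<delta>))
      \<le> L powr -(1 + \<delta>) + (L powr -\<delta> - (L + real n) powr -\<delta>) / \<delta>" for n
  proof (induction n)
    case 0 then show ?case by simp
  next
    case (Suc n)
    show ?case
      using Suc powr_telescope(2)[of "L + real n" \<delta>] L \<delta>
      by (simp add: diff_divide_distrib add_ac)
  qed
  from this[of n] have "(\<Sum>i<Suc n. (L + real i) powr -(1 + \<delta>)) \<le> L powr -(1 + \<delta>) + L powr -\<delta> / \<delta>"
    using \<delta> by (simp add: diff_divide_distrib) (smt (verit) divide_nonneg_pos powr_ge_zero)
  moreover have "(\<Sum>i<n. (L + real i) powr -(1 + \<delta>)) \<le> (\<Sum>i<Suc n. (L + real i) powr -(1 + \<delta>))"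
    by simp
  ultimately have "(\<Sum>i<n. (L + real i) powr -(1 + \<delta>)) \<le> L powr -(1 + \<delta>) + L powr -\<delta> / \<delta>"
    by (rule order_trans[rotated])
  then show "(\<Sum>i<n. ennreal ((L + real i) powr -(1 + \<delta>))) \<le> ennreal (L powr -(1 + \<delta>) + L powr -\<delta> / \<delta>)"
    by (subst sum_ennreal) (simp_all only: ennreal_leI powr_ge_zero)
qed simp

lemma sum_powr_ge:
  fixes \<delta> :: real and a b :: nat
  assumes a: "0 < a" and ab: "a \<le> b" and \<delta>: "0 < \<delta>"
  shows "(real a powr -\<delta> - (real b + 1) powr -\<delta>) / \<delta> \<le> (\<Sum>j=a..b. real j powr -(1 + \<delta>))"
  using ab
proof (induction b rule: dec_induct)
  case base
  show ?case using powr_telescope(1)[of "real a" \<delta>] a \<delta> by simp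
next
  case (step n)
  show ?case
    using step powr_telescope(1)[of "real n + 1" \<delta>] a \<delta>
    by (simp add: diff_divide_distrib add_ac)
qed

section \<open>The upper bound\<close>

text \<open>
  Up to constants, \<open>r / \<bar>w\<bar>\<close> is the radius of each preimage of the ball with centre \<open>w\<close> and
  radius \<open>r\<close>.
\<close>

definition ball_cost :: "real \<Rightarrow> real \<Rightarrow> complex \<times> real \<Rightarrow> ennreal" where
  "ball_cost L s = (\<lambda>(w, r). if L \<le> Re w \<and> 0 \<le> r \<and> r \<le> 1 then ennreal ((r / norm w) powr s) else top)"

text \<open>
  The preimage under the branch \<open>k\<close> lies in the ball with centre \<open>\<phi>\<^sub>k w\<close> and radius \<open>2 r / \<bar>w\<bar>\<close>, which
  is charged at most \<open>(16 r / \<bar>w\<bar>)\<^sup>s (L + n)\<^sup>-\<^sup>s\<close> if \<open>k = int_decode n\<close>. The sum over \<open>n\<close> is at most half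
  the charge \<open>(r / \<bar>w\<bar>)\<^sup>s\<close> of the original ball.
\<close>

lemma exp_map_contracts_ball_cost:
  assumes L: "2 \<le> L" and s: "1 < s"
    and small: "16 powr s * (L powr -s + L powr (1 - s) / (s - 1)) \<le> 1 / 2"
  shows "2 * cover_content (case_prod ball) (ball_cost L s)
           {z \<in> {z. L \<le> Re z}. exp_map (exp (-L)) z \<in> case_prod ball b} \<le> ball_cost L s b"
proof -
  obtain w r where b: "b = (w, r)" by (cases b)
  show ?thesis
  proof (cases "L \<le> Re w \<and> 0 \<le> r \<and> r \<le> 1")
    case False
    then show ?thesis by (auto simp: b ball_cost_def)
  next
    case True
    then have w: "L \<le> Re w" "2 \<le> norm w" and r: "0 \<le> r" "r \<le> 1"
      using L complex_Re_le_cmod[of w] by auto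
    have w0: "w \<noteq> 0" using w by auto
    let ?A = "{z \<in> {z. L \<le> Re z}. exp_map (exp (-L)) z \<in> ball w r}"
    let ?u = "\<lambda>n. (branch L (int_decode n) w, 2 * r / norm w)"
    have "?A \<subseteq> (\<Union>n. case_prod ball (?u n))"
    proof
      fix z assume z: "z \<in> ?A"
      then have "exp_map (exp (-L)) z \<noteq> 0" by (simp add: exp_map_exp)
      then obtain k where k: "z = branch L k (exp_map (exp (-L)) z)"
        using exp_map_eq_branch by blast
      have "dist (branch L k w) (branch L k (exp_map (exp (-L)) z)) < 2 * r / norm w"
        using branch_dist[of w r "exp_map (exp (-L)) z" L k] z r w L by auto
      then have "dist (branch L k w) z < 2 * r / norm w" using k by simp
      then show "z \<in> (\<Union>n. case_prod ball (?u n))" by (intro UN_I[of "int_encode k"]) auto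
    qed
    then have "cover_content (case_prod ball) (ball_cost L s) ?A \<le> (\<Sum>n. ball_cost L s (?u n))"
      by (rule cover_content_le)
    also have "\<dots> \<le> (\<Sum>n. ennreal ((r / norm w) powr s * 16 powr s) * ennreal ((L + real n) powr -s))"
    proof (intro suminf_le)
      fix n
      let ?z = "branch L (int_decode n) w"
      have "0 \<le> ln (norm w)" using w by (intro ln_ge_zero) auto
      then have "L \<le> Re ?z" using w0 by (simp add: branch_Re)
      moreover have "2 * r / norm w \<le> 1" using w r by (subst divide_le_eq) auto
      moreover have "0 \<le> 2 * r / norm w" using r by simp
      ultimately have "ball_cost L s (?u n) = ennreal ((2 * r / norm w / norm ?z) powr s)"
        by (simp add: ball_cost_def)
      also have "\<dots> \<le> ennreal ((2 * r / norm w / ((L + real n) / 8)) powr s)"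
        using branch_norm_ge[of L w n] L w r s
        by (intro ennreal_leI powr_mono2 divide_left_mono mult_pos_pos)
           (auto intro!: divide_nonneg_nonneg)
      also have "2 * r / norm w / ((L + real n) / 8) = (r / norm w) * 16 / (L + real n)"
        by simp
      also have "\<dots> powr s = (r / norm w) powr s * 16 powr s * (L + real n) powr -s"
        using r L by (simp add: powr_mult powr_divide powr_minus divide_inverse inverse_powr)
      finally show "ball_cost L s (?u n)
          \<le> ennreal ((r / norm w) powr s * 16 powr s) * ennreal ((L + real n) powr -s)"
        by (simp add: ennreal_mult)
    qed auto
    also have "\<dots> = ennreal ((r / norm w) powr s * 16 powr s) * (\<Sum>n. ennreal ((L + real n) powr -s))"
      by simp
    also have "\<dots> \<le> ennreal ((r / norm w) powr s * 16 powr s) * ennreal (L powr -s + L powr (1 - s) / (s - 1))"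
    proof (rule mult_left_mono)
      have e: "1 + (s - 1) = s" "- (s - 1) = 1 - s" by simp_all
      have "0 < L" "0 < s - 1" using L s by auto
      from suminf_powr_le[OF this]
      show "(\<Sum>n. ennreal ((L + real n) powr -s)) \<le> ennreal (L powr -s + L powr (1 - s) / (s - 1))"
        by (simp only: e)
    qed simp
    also have "\<dots> = ennreal ((r / norm w) powr s * (16 powr s * (L powr -s + L powr (1 - s) / (s - 1))))"
      using s by (simp add: ennreal_mult mult_ac)
    also have "\<dots> \<le> ennreal ((r / norm w) powr s * (1 / 2))"
      using small by (intro ennreal_leI mult_left_mono) auto
    finally have "2 * cover_content (case_prod ball) (ball_cost L s) ?A \<le> 2 * ennreal ((r / norm w) powr s * (1 / 2))"
      by (rule mult_left_mono) simp
    also have "\<dots> = ennreal ((r / norm w) powr s)"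
      by (simp add: ennreal_mult[symmetric] flip: ennreal_numeral)
    also have "\<dots> = ball_cost L s b" using True by (simp add: b ball_cost_def)
    finally show ?thesis by (simp add: b)
  qed
qed

text \<open>
  A point of the Julia set that does not escape returns infinitely often to a set
  \<open>{\<bar>z\<bar> \<le> B, Re z \<ge> L}\<close>, which is compact and so has finite content.
\<close>

lemma julia_r_content_null:
  assumes L: "2 \<le> L" and s: "1 < s"
    and small: "16 powr s * (L powr -s + L powr (1 - s) / (s - 1)) \<le> 1 / 2"
  shows "cover_content (case_prod ball) (ball_cost L s) (julia_r (exp_map (exp (-L)))) = 0"
proof -
  let ?f = "exp_map (exp (-L))" let ?W = "cover_content (case_prod ball) (ball_cost L s)"
  let ?H = "{z. L \<le> Re z}"
  define A where "A B = cball (0::complex) (real B) \<inter> ?H" for B :: nat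
  define R where "R B = {z. (\<forall>n. (?f ^^ n) z \<in> ?H) \<and> (\<exists>\<^sub>F n in sequentially. (?f ^^ n) z \<in> A B)}" for B
  have "?W (R B) = 0" for B
    unfolding R_def
  proof (rule cover_content_limsup_null)
    show "2 * ?W {z \<in> ?H. ?f z \<in> case_prod ball b} \<le> ball_cost L s b" for b
      by (rule exp_map_contracts_ball_cost[OF L s small])
    have "compact (A B)" unfolding A_def
      by (intro compact_Int_closed closed_halfspace_Re_ge) auto
    then obtain k where k: "finite k" "k \<subseteq> A B" "A B \<subseteq> (\<Union>x\<in>k. ball x 1)"
      by (rule compactE_image[of "A B" "A B" "\<lambda>x. ball x 1"]) (auto intro: that)
    show "?W (A B) < top"
    proof (rule cover_content_UN_finite)
      show "finite ((\<lambda>x. (x, 1)) ` k)" using k by simp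
      show "ball_cost L s b < top" if "b \<in> (\<lambda>x. (x, 1)) ` k" for b
        using that k(2) by (auto simp: ball_cost_def A_def)
      \<comment> \<open>balls of radius \<open>0\<close> are empty and pad a finite covering to a sequence\<close>
      show "ball_cost L s (of_real L, 0) = 0" by (simp add: ball_cost_def)
      show "A B \<subseteq> (\<Union>b\<in>(\<lambda>x. (x, 1)) ` k. case_prod ball b)" using k(3) by simp
    qed
  qed
  then have "?W (\<Union>B. R B) = 0" by (rule cover_content_UN_null)
  moreover have "julia_r ?f \<subseteq> (\<Union>B. R B)"
  proof
    fix z assume z: "z \<in> julia_r ?f"
    have H: "L \<le> Re ((?f ^^ n) z)" for n
      using z L by (intro julia_orbit_ge) (auto simp: julia_r_def)
    have "\<not> filterlim (\<lambda>n. (?f ^^ n) z) at_infinity sequentially"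
      using z by (simp add: julia_r_def escaping_set_def)
    then obtain b where "\<not> (\<forall>\<^sub>F n in sequentially. b < norm ((?f ^^ n) z))"
      by (auto simp: filterlim_at_infinity_conv_norm_at_top filterlim_at_top_dense)
    then have b: "\<exists>\<^sub>F n in sequentially. norm ((?f ^^ n) z) \<le> b"
      by (simp add: not_eventually not_less)
    obtain B :: nat where "b \<le> real B" using real_arch_simple by blast
    then have "\<exists>\<^sub>F n in sequentially. (?f ^^ n) z \<in> A B"
      by (intro frequently_mono[OF _ b]) (auto simp: A_def H)
    then show "z \<in> (\<Union>B. R B)" using H by (auto simp: R_def)
  qed
  ultimately show ?thesis using cover_content_mono[of "julia_r ?f" "\<Union>B. R B"] by (metis le_zero_eq)
qed

text \<open>
  On a bounded set the weight \<open>\<bar>w\<bar>\<^sup>-\<^sup>s\<close> is bounded below, so the charge of a ball controls \<open>diam\<^sup>s\<close>.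
\<close>

lemma hausdorff_content_null_if_ball_content_null:
  assumes s: "0 < s" and L: "0 < L" and null: "cover_content (case_prod ball) (ball_cost L s) A = 0"
    and M: "A \<subseteq> cball 0 M" "0 \<le> M"
  shows "cover_content (\<lambda>U. U) (hausdorff_cost s) A = 0"
proof -
  define C where "C = (2 * (M + 1)) powr s"
  have C: "0 < C" using M by (simp add: C_def)
  have cost: "hausdorff_cost s (case_prod ball b \<inter> cball 0 M) \<le> ennreal C * ball_cost L s b" for b
  proof -
    obtain w r where b: "b = (w, r)" by (cases b)
    let ?U = "ball w r \<inter> cball 0 M"
    consider "?U = {}" | "\<not> (L \<le> Re w \<and> 0 \<le> r \<and> r \<le> 1)" | "?U \<noteq> {}" "L \<le> Re w" "0 \<le> r" "r \<le> 1"
      by blast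
    then show ?thesis
    proof cases
      case 1 then show ?thesis by (simp add: b hausdorff_cost_def diam_power_def)
    next
      case 2 then show ?thesis using C by (auto simp: b ball_cost_def ennreal_mult_top)
    next
      case 3
      then obtain v where "dist w v < r" "norm v \<le> M" by auto
      then have nw: "norm w \<le> M + 1"
        using \<open>r \<le> 1\<close> norm_triangle_ineq2[of w v] by (simp add: dist_norm)
      have w: "0 < norm w" using 3 L complex_Re_le_cmod[of w] by linarith
      have "diameter ?U \<le> diameter (ball w r)"
        by (rule diameter_subset) auto
      also have "\<dots> = 2 * r" using \<open>0 \<le> r\<close> by (subst diameter_ball) auto
      also have "\<dots> \<le> 2 * (M + 1) * (r / norm w)"
        using nw w \<open>0 \<le> r\<close> mult_right_mono[OF nw \<open>0 \<le> r\<close>] by (simp add: field_simps)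
      finally have "diameter ?U powr s \<le> (2 * (M + 1) * (r / norm w)) powr s"
        using s by (intro powr_mono2) (auto intro: diameter_ge_0)
      also have "\<dots> = C * (r / norm w) powr s"
        unfolding C_def using M 3 by (intro powr_mult)
      finally have "diameter ?U powr s \<le> C * (r / norm w) powr s" .
      moreover have "bounded ?U" by (rule bounded_Int) simp
      ultimately show ?thesis
        using 3 s C by (simp add: b hausdorff_cost_def diam_power_def ball_cost_def ennreal_mult[symmetric] ennreal_leI)
    qed
  qed
  have "cover_content (\<lambda>U. U) (hausdorff_cost s) A \<le> 0 + ennreal e" if e: "0 < e" for e
  proof -
    have "cover_content (case_prod ball) (ball_cost L s) A < ennreal (e / C)" using null e C by simp
    then obtain u where u: "A \<subseteq> (\<Union>i. case_prod ball (u i))" "(\<Sum>i. ball_cost L s (u i)) < ennreal (e / C)"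
      by (rule cover_content_lessE)
    have "cover_content (\<lambda>U. U) (hausdorff_cost s) A \<le> (\<Sum>i. hausdorff_cost s (case_prod ball (u i) \<inter> cball 0 M))"
    proof (rule cover_content_le, rule subsetI)
      fix z assume "z \<in> A"
      from subsetD[OF u(1) this] obtain i where "z \<in> case_prod ball (u i)" by (rule UN_E)
      with \<open>z \<in> A\<close> M(1) show "z \<in> (\<Union>i. case_prod ball (u i) \<inter> cball 0 M)"
        by (intro UN_I[of i]) auto
    qed
    also have "\<dots> \<le> (\<Sum>i. ennreal C * ball_cost L s (u i))"
      by (intro suminf_le cost) auto
    also have "\<dots> = ennreal C * (\<Sum>i. ball_cost L s (u i))" by simp
    also have "\<dots> \<le> ennreal C * ennreal (e / C)"
      using u(2) by (intro mult_left_mono) auto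
    also have "\<dots> = ennreal e" using C e by (simp add: ennreal_mult[symmetric])
    finally show ?thesis by simp
  qed
  then have "cover_content (\<lambda>U. U) (hausdorff_cost s) A \<le> 0"
    by (rule ennreal_le_epsilon)
  then show ?thesis by simp
qed

lemma hausdorff_dim_julia_r_le:
  assumes L: "2 \<le> L" and s: "1 < s"
    and small: "16 powr s * (L powr -s + L powr (1 - s) / (s - 1)) \<le> 1 / 2"
  shows "hausdorff_dim (julia_r (exp_map (exp (-L)))) \<le> ereal s"
proof -
  let ?J = "julia_r (exp_map (exp (-L)))"
  have "cover_content (\<lambda>U. U) (hausdorff_cost s) (\<Union>M::nat. ?J \<inter> cball 0 (real M)) = 0"
  proof (rule cover_content_UN_null)
    fix M :: nat
    have "cover_content (case_prod ball) (ball_cost L s) (?J \<inter> cball 0 (real M)) = 0"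
      using cover_content_mono[of "?J \<inter> cball 0 (real M)" ?J "case_prod ball" "ball_cost L s"]
        julia_r_content_null[OF assms] by simp
    then show "cover_content (\<lambda>U. U) (hausdorff_cost s) (?J \<inter> cball 0 (real M)) = 0"
      by (rule hausdorff_content_null_if_ball_content_null[rotated 2]) (use L s in auto)
  qed
  moreover have "(\<Union>M::nat. ?J \<inter> cball 0 (real M)) = ?J"
    using real_arch_simple by auto
  ultimately have "hausdorff_measure s ?J = 0"
    using s by (intro hausdorff_measure_null) auto
  then show ?thesis using s by (intro hausdorff_dim_le) auto
qed

text \<open>
  For \<open>\<delta> = ln ln L / ln L\<close> one has \<open>L\<^sup>-\<^sup>\<delta> = 1 / ln L\<close>, so \<open>L\<^sup>-\<^sup>\<delta> / \<delta> = 1 / ln ln L\<close> tends to zero.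
\<close>

lemma eventually_upper_exponent:
  "\<forall>\<^sub>F L :: real in at_top. 16 powr (1 + ln (ln L) / ln L) *
     (L powr -(1 + ln (ln L) / ln L) + L powr -(ln (ln L) / ln L) / (ln (ln L) / ln L)) \<le> 1 / 2"
  by real_asymp

lemma eventually_julia_r_le:
  "\<forall>\<^sub>F L in at_top. hausdorff_dim (julia_r (exp_map (exp (-L)))) \<le> ereal (1 + ln (ln L) / ln L)"
proof -
  have "\<forall>\<^sub>F L :: real in at_top. 2 \<le> L \<and> 0 < ln (ln L) / ln L"
    by (intro eventually_conj) real_asymp+
  with eventually_upper_exponent show ?thesis
    by eventually_elim (intro hausdorff_dim_julia_r_le, auto)
qed

section \<open>The lower bound\<close>

lemma exp_map_lipschitz:
  assumes "norm (z - z') \<le> 1"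
  shows "norm (exp_map (exp (-L)) z - exp_map (exp (-L)) z') \<le> 3 * norm (exp_map (exp (-L)) z) * norm (z - z')"
proof -
  let ?f = "exp_map (exp (-L))"
  have "norm (?f z' - ?f z) \<le> 3 * norm (?f z) * norm (z' - z)"
  proof (rule field_differentiable_bound[of "cball z 1" _ ?f])
    fix x assume "x \<in> cball z 1"
    then have "Re x \<le> 1 + Re z"
      using complex_Re_le_cmod[of "x - z"] by (simp add: dist_norm norm_minus_commute)
    \<comment> \<open>within distance \<open>1\<close> the derivative changes by a factor of at most \<open>e < 3\<close>\<close>
    then have "norm (?f x) \<le> exp 1 * norm (?f z)"
      by (simp add: norm_exp_map flip: exp_add)
    also have "\<dots> \<le> 3 * norm (?f z)" using exp_le by (intro mult_right_mono) auto
    finally show "norm (?f x) \<le> 3 * norm (?f z)" .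
  qed (use assms exp_map_deriv in \<open>auto simp: dist_norm\<close>)
  then show ?thesis by (simp add: norm_minus_commute)
qed

lemma sum_UN_le:
  fixes f :: "'a \<Rightarrow> real"
  assumes "finite M" "\<And>i. i \<in> M \<Longrightarrow> finite (P i)" "\<And>x. 0 \<le> f x"
  shows "sum f (\<Union>i\<in>M. P i) \<le> (\<Sum>i\<in>M. sum f (P i))"
  using assms(1,2)
proof (induction M rule: finite_induct)
  case (insert i M)
  have "sum f (P i \<union> (\<Union>i\<in>M. P i)) \<le> sum f (P i) + sum f (\<Union>i\<in>M. P i)"
    using insert.prems insert.hyps assms(3) by (simp add: sum_Un sum_nonneg)
  also have "\<dots> \<le> sum f (P i) + (\<Sum>i\<in>M. sum f (P i))"
    using insert by auto
  finally show ?case using insert.hyps by simp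
qed simp

text \<open>
  The tile with number \<open>j\<close> is the part of the strip of width \<open>\<pi>\<close> around \<open>Im z = 2\<pi>j\<close> with
  \<open>L \<le> Re z \<le> 2 L\<close>. The condition \<open>ln (10 j) \<le> L\<close> makes the branch \<open>k\<close> map all tiles into the tile \<open>k\<close>:
  points of the tile \<open>j\<close> have modulus at most \<open>10 j\<close>, so their preimages have real part at most \<open>2 L\<close>.
  The lower bound for the sum is the expansion needed for dimension \<open>s\<close>; it involves \<open>30 j\<close> because
  \<open>\<bar>E'\<bar> \<le> 3 \<cdot> 10 j\<close> near the points that are mapped to the tile \<open>j\<close>.
\<close>

locale expanding_tiles =
  fixes L s :: real and J :: "nat set"
  assumes L: "2 \<le> L" and s: "1 < s" and fin: "finite J"
    and J_ge: "\<And>j. j \<in> J \<Longrightarrow> L \<le> real j"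
    and J_le: "\<And>j. j \<in> J \<Longrightarrow> ln (10 * real j) \<le> L"
    and mass: "1 \<le> (\<Sum>j\<in>J. (30 * real j) powr -s)"
begin

abbreviation "E \<equiv> exp_map (exp (-L))"

definition tile :: "nat \<Rightarrow> complex set" where
  "tile j = cbox (Complex L (2 * pi * real j - pi / 2)) (Complex (2 * L) (2 * pi * real j + pi / 2))"

definition K :: "complex set" where
  "K = {z. \<forall>n. (E ^^ n) z \<in> (\<Union>j\<in>J. tile j)}"

lemma mem_tile: "z \<in> tile j \<longleftrightarrow> L \<le> Re z \<and> Re z \<le> 2 * L \<and> \<bar>Im z - 2 * pi * real j\<bar> \<le> pi / 2"
  unfolding tile_def in_cbox_complex_iff complex.sel abs_diff_le_iff by auto

lemma norm_tile:
  assumes z: "z \<in> tile j" and j: "j \<in> J"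
  shows "norm z \<le> 10 * real j"
proof -
  have "pi * real j \<le> 3.2 * real j" using pi_approx by (intro mult_right_mono) auto
  moreover have "0 \<le> pi * real j" by simp
  moreover have "norm z \<le> \<bar>Re z\<bar> + \<bar>Im z\<bar>" by (rule cmod_le)
  ultimately show ?thesis
    using z[unfolded mem_tile] J_ge[OF j] L pi_less_4 by linarith
qed

lemma branch_in_tile:
  assumes "w \<in> (\<Union>j\<in>J. tile j)"
  shows "branch L (int k) w \<in> tile k" "E (branch L (int k) w) = w"
proof -
  obtain j where j: "j \<in> J" "w \<in> tile j" using assms by blast
  then have w: "L \<le> Re w" by (simp add: mem_tile)
  then have "2 \<le> norm w" using L complex_Re_le_cmod[of w] by linarith
  then have w0: "w \<noteq> 0" and ln0: "0 \<le> ln (norm w)" by (auto intro: ln_ge_zero)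
  have "ln (norm w) \<le> ln (10 * real j)"
    using norm_tile[OF j(2,1)] w0 J_ge[OF j(1)] L by (subst ln_le_cancel_iff) auto
  then have "ln (norm w) \<le> L" using J_le[OF j(1)] by linarith
  then show "branch L (int k) w \<in> tile k"
    using branch_Im[of w L "int k"] w L ln0 w0 by (auto simp: mem_tile branch_Re)
  show "E (branch L (int k) w) = w" by (rule exp_map_branch[OF w0])
qed

lemma K_subset: "K \<subseteq> (\<Union>j\<in>J. tile j)"
proof
  fix z assume "z \<in> K"
  then have "(E ^^ 0) z \<in> (\<Union>j\<in>J. tile j)" unfolding K_def by blast
  then show "z \<in> (\<Union>j\<in>J. tile j)" by simp
qed

lemma E_K: "z \<in> K \<Longrightarrow> E z \<in> K"
  unfolding K_def mem_Collect_eq by (metis funpow_swap1 funpow.simps(2) o_apply)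

lemma K_I: "z \<in> (\<Union>j\<in>J. tile j) \<Longrightarrow> E z \<in> K \<Longrightarrow> z \<in> K"
  unfolding K_def mem_Collect_eq
proof
  fix n assume "z \<in> (\<Union>j\<in>J. tile j)" "\<forall>n. (E ^^ n) (E z) \<in> (\<Union>j\<in>J. tile j)"
  then show "(E ^^ n) z \<in> (\<Union>j\<in>J. tile j)" by (cases n) (simp_all add: funpow_swap1)
qed

lemma branch_K:
  assumes "w \<in> K" "k \<in> J"
  shows "branch L (int k) w \<in> K \<inter> tile k" "E (branch L (int k) w) = w"
proof -
  have w: "w \<in> (\<Union>j\<in>J. tile j)" using assms(1) K_subset by blast
  show eq: "E (branch L (int k) w) = w" by (rule branch_in_tile(2)[OF w])
  show "branch L (int k) w \<in> K \<inter> tile k"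
    using branch_in_tile(1)[OF w, of k] K_I[of "branch L (int k) w"] assms eq by auto
qed

lemma compact_K: "compact K"
proof -
  have cl: "closed (\<Union>j\<in>J. tile j)" using fin by (auto simp: tile_def)
  have "K = (\<Inter>n. (E ^^ n) -` (\<Union>j\<in>J. tile j))" by (auto simp: K_def)
  moreover have "closed ((E ^^ n) -` (\<Union>j\<in>J. tile j))" for n
    using holomorphic_on_imp_continuous_on[OF funpow_exp_holomorphic[where D = UNIV]] cl
    by (intro continuous_closed_vimage) (auto simp: continuous_on_eq_continuous_at)
  ultimately have "closed K" by (metis closed_INT)
  moreover have "bounded (\<Union>j\<in>J. tile j)" using fin by (auto simp: tile_def)
  then have "bounded K" using K_subset by (rule bounded_subset)
  ultimately show ?thesis by (simp add: compact_eq_bounded_closed)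
qed

text \<open>
  The branch \<open>k\<close> has a fixed point in the tile \<open>k\<close>.
\<close>

lemma K_nonempty: assumes "k \<in> J" shows "K \<inter> tile k \<noteq> {}"
proof -
  have sub: "tile k \<subseteq> (\<Union>j\<in>J. tile j)" using assms by blast
  have "continuous_on (tile k) (branch L (int k))"
    unfolding branch_def[abs_def] using L
    by (intro continuous_intros) (auto simp: mem_tile complex_nonpos_Reals_iff)
  moreover have "compact (tile k)" "convex (tile k)"
    unfolding tile_def by (rule compact_cbox, rule convex_box)
  moreover have "Complex L (2 * pi * real k) \<in> tile k" using L by (auto simp: mem_tile)
  then have "tile k \<noteq> {}" by blast
  moreover have "branch L (int k) \<in> tile k \<rightarrow> tile k"
    using branch_in_tile(1) sub by blast
  ultimately obtain x where x: "x \<in> tile k" "branch L (int k) x = x"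
    by (metis brouwer)
  then have "E x = x" using branch_in_tile(2)[of x k] sub by auto
  then have "(E ^^ n) x = x" for n by (induction n) auto
  then have "x \<in> K" using x sub by (auto simp: K_def)
  then show ?thesis using x by blast
qed

text \<open>
  A single term of the sum is less than \<open>1\<close>.
\<close>

lemma J_other: assumes "j \<in> J" obtains j' where "j' \<in> J" "j' \<noteq> j"
proof -
  have "(30 * real j) powr -s < 1"
    using J_ge[OF assms] L s by (intro powr_less_one) auto
  then have "J \<noteq> {j}" using mass by auto
  then show ?thesis using assms that by blast
qed

lemma tile_gap:
  assumes "z \<in> tile j" "z' \<in> tile j'" "j \<le> j'"
  shows "3 * (real j' - real j) \<le> norm (z - z') \<or> j = j'"
proof (cases "j = j'")
  case False
  then have n: "1 \<le> real j' - real j" using assms(3) by linarith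
  have "2 * pi * (real j' - real j) - pi \<le> \<bar>Im (z - z')\<bar>"
    using assms(1,2) unfolding mem_tile right_diff_distrib minus_complex.sel by linarith
  moreover have "pi \<le> pi * (real j' - real j)" "3 * (real j' - real j) \<le> pi * (real j' - real j)"
    using n mult_right_mono[of 1 "real j' - real j" pi] mult_right_mono[of 3 pi "real j' - real j"] pi_gt3
    by (simp_all add: mult.commute)
  ultimately show ?thesis using abs_Im_le_cmod[of "z - z'"] by linarith
qed simp

lemma image_bound:
  assumes z: "z \<in> V" "E z \<in> tile j" "j \<in> J" and z': "z' \<in> V" and V: "bounded V" "diameter V < 1"
  shows "norm (E z - E z') \<le> 30 * real j * diameter V"
proof -
  have d: "norm (z - z') \<le> diameter V"
    using diameter_bounded_bound[OF V(1) z(1) z'] by (simp add: dist_norm)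
  have "norm (E z - E z') \<le> 3 * norm (E z) * norm (z - z')"
    using d V by (intro exp_map_lipschitz) auto
  also have "\<dots> \<le> (3 * (10 * real j)) * diameter V"
    using d norm_tile[OF z(2,3)] by (intro mult_mono) auto
  finally show ?thesis by simp
qed

text \<open>
  A set whose image meets several tiles has an image at least as long as the gaps between them; being
  expanded by a factor of at most \<open>30 a\<close>, with \<open>a\<close> the lowest of these tiles, it is itself so large that
  it pays for all the tiles that it meets.
\<close>

lemma multi_tile_bound:
  assumes V: "bounded V" "diameter V < 1"
    and P: "P \<subseteq> J" "2 \<le> card P" "\<And>j. j \<in> P \<Longrightarrow> \<exists>z\<in>V. E z \<in> tile j"
  shows "(\<Sum>j\<in>P. (30 * real j) powr -s) \<le> diameter V powr s"
proof -
  have finP: "finite P" "P \<noteq> {}" using P(2) by (auto intro: card_ge_0_finite)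
  define a b where "a = Min P" and "b = Max P"
  have ab: "a \<in> P" "b \<in> P" and Pab: "P \<subseteq> {a..b}" using finP by (auto simp: a_def b_def)
  have card: "card P \<le> b + 1 - a" using card_mono[OF _ Pab] by simp
  then have less: "a < b" using P(2) by linarith
  define n where "n = real b - real a"
  have n: "1 \<le> n" "real (card P) \<le> 2 * n" using less card by (auto simp: n_def)
  have a: "2 \<le> real a" using J_ge[of a] ab P(1) L by force
  obtain z z' where z: "z \<in> V" "E z \<in> tile a" "z' \<in> V" "E z' \<in> tile b" using P(3) ab by meson
  have "3 * n \<le> norm (E z - E z')"
    using tile_gap[OF z(2,4)] less by (auto simp: n_def)
  also have "\<dots> \<le> 30 * real a * diameter V"
    using z ab P(1) V by (intro image_bound) auto
  finally have "3 * n / (30 * real a) \<le> diameter V" using a by (simp add: field_simps)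
  then have d: "(3 * n / (30 * real a)) powr s \<le> diameter V powr s"
    using n a s by (intro powr_mono2) auto
  have "(\<Sum>j\<in>P. (30 * real j) powr -s) \<le> (\<Sum>j\<in>P. (30 * real a) powr -s)"
    using Pab a s by (intro sum_mono powr_mono2') auto
  also have "\<dots> = real (card P) * (30 * real a) powr -s" by simp
  also have "\<dots> \<le> (3 * n) powr s * (30 * real a) powr -s"
  proof (intro mult_right_mono)
    have "(3 * n) powr 1 \<le> (3 * n) powr s" using n s by (intro powr_mono) auto
    then show "real (card P) \<le> (3 * n) powr s" using n by simp
  qed simp
  also have "\<dots> = (3 * n / (30 * real a)) powr s"
    using n a by (subst powr_divide) (auto simp: powr_minus field_simps)
  finally show ?thesis using d by linarith
qed

text \<open>
  The mass \<open>1\<close> of the piece of \<open>K\<close> in the tile \<open>k\<close> is distributed over its subpieces, the preimages of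
  \<open>K \<inter> tile j\<close>, with shares of \<open>(30 j)\<^sup>-\<^sup>s\<close> that add up to at least \<open>1\<close>. Either \<open>j\<close> is met by a covering set
  that meets several subpieces (\<open>i \<in> M\<close>), and this set pays for \<open>j\<close> by \<open>multi_tile_bound\<close>; or all sets
  that meet the subpiece \<open>j\<close> meet no other one (\<open>j \<in> T\<close>, \<open>i \<in> Q j\<close>), and then their images under \<open>E\<close> cover
  \<open>K \<inter> tile j\<close> and are at most \<open>30 j\<close> times as large, so the induction hypothesis applies to them. There
  are fewer of them, as at least one other subpiece has to be covered as well.
\<close>

lemma finite_cover_sum_ge_1:
  fixes I :: "nat set"
  assumes "finite I" "\<And>i. i \<in> I \<Longrightarrow> bounded (U i)" "k \<in> J" "K \<inter> tile k \<subseteq> (\<Union>i\<in>I. U i)"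
  shows "1 \<le> (\<Sum>i\<in>I. diameter (U i) powr s)"
  using assms
proof (induction I arbitrary: U k rule: finite_psubset_induct)
  case (psubset I)
  \<comment> \<open>intersecting with \<open>K\<close> ensures that every point of \<open>V i\<close> is mapped to some tile\<close>
  define V where "V i = U i \<inter> (K \<inter> tile k)" for i
  define d where "d i = diameter (V i)" for i
  have bV: "bounded (V i)" if "i \<in> I" for i using psubset.prems(1)[OF that] by (auto simp: V_def)
  have d0: "0 \<le> d i" if "i \<in> I" for i unfolding d_def by (rule diameter_ge_0[OF bV[OF that]])
  have dU: "d i \<le> diameter (U i)" if "i \<in> I" for i
    unfolding d_def using psubset.prems(1)[OF that] by (intro diameter_subset) (auto simp: V_def)
  have "1 \<le> (\<Sum>i\<in>I. d i powr s)"
  proof (cases "\<exists>i\<in>I. 1 \<le> d i")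
    case True
    then obtain i where i: "i \<in> I" "1 \<le> d i" by blast
    have "1 \<le> d i powr s" using i s by (intro ge_one_powr_ge_zero) auto
    also have "\<dots> \<le> (\<Sum>i\<in>I. d i powr s)"
      using psubset.hyps i by (intro member_le_sum) auto
    finally show ?thesis .
  next
    case False
    then have d1: "d i < 1" if "i \<in> I" for i using that by (meson not_less)
    define P where "P i = {j \<in> J. \<exists>z\<in>V i. E z \<in> tile j}" for i
    have P_sub: "P i \<subseteq> J" and fin_P: "finite (P i)" for i
      using fin by (auto simp: P_def intro: finite_subset)
    have VK: "V i \<subseteq> K" for i by (auto simp: V_def)
    have cover: "\<exists>i\<in>I. \<exists>z\<in>V i. E z = w \<and> j \<in> P i" if "w \<in> K \<inter> tile j" "j \<in> J" for w j
    proof -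
      have b: "branch L (int k) w \<in> K \<inter> tile k" "E (branch L (int k) w) = w"
        using branch_K psubset.prems(2) that by auto
      then obtain i where "i \<in> I" "branch L (int k) w \<in> V i"
        using psubset.prems(3) by (auto simp: V_def)
      moreover have "j \<in> P i" using calculation b that
        by (auto simp: P_def intro!: bexI[of _ "branch L (int k) w"])
      ultimately show ?thesis using b(2) by blast
    qed
    define T where "T = {j \<in> J. \<forall>i\<in>I. j \<in> P i \<longrightarrow> P i = {j}}"
    define Q where "Q j = {i \<in> I. P i = {j}}" for j
    define M where "M = {i \<in> I. 2 \<le> card (P i)}"
    have finI: "finite I" and finQ: "finite (Q j)" and finM: "finite M" for j
      using psubset.hyps by (auto simp: Q_def M_def)
    have single: "(30 * real j) powr -s \<le> (\<Sum>i\<in>Q j. d i powr s)" if j: "j \<in> T" for j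
    proof -
      have jJ: "j \<in> J" and j0: "0 < real j" using j J_ge[of j] L by (auto simp: T_def)
      obtain j' where j': "j' \<in> J" "j' \<noteq> j" using J_other[OF jJ] .
      obtain w where "w \<in> K \<inter> tile j'" using K_nonempty[OF j'(1)] by blast
      then obtain i where "i \<in> I" "j' \<in> P i" using cover j'(1) by blast
      then have "Q j \<subset> I" using j' by (auto simp: Q_def)
      have V_tile: "E z \<in> tile j" if "i \<in> Q j" "z \<in> V i" for i z
      proof -
        have "E z \<in> K" using that VK E_K by blast
        then obtain j'' where "j'' \<in> J" "E z \<in> tile j''" using K_subset by blast
        then have "j'' \<in> P i" using that by (auto simp: P_def)
        then show ?thesis using that \<open>E z \<in> tile j''\<close> by (auto simp: Q_def)
      qed
      have EV: "diameter (E ` V i) \<le> 30 * real j * d i" if i: "i \<in> Q j" for i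
      proof (rule diameter_le)
        have iI: "i \<in> I" using i by (simp add: Q_def)
        show "E ` V i \<noteq> {} \<or> 0 \<le> 30 * real j * d i" using d0[OF iI] by simp
        fix x y assume "x \<in> E ` V i" "y \<in> E ` V i"
        then show "norm (x - y) \<le> 30 * real j * d i"
          using image_bound[of _ "V i" j] V_tile[OF i] jJ bV[OF iI] d1[OF iI] by (auto simp: d_def)
      qed
      have "1 \<le> (\<Sum>i\<in>Q j. diameter (E ` V i) powr s)"
      proof (rule psubset.IH[OF \<open>Q j \<subset> I\<close> _ jJ])
        show "bounded (E ` V i)" if "i \<in> Q j" for i
          by (rule bounded_subset[of "tile j"]) (use V_tile that in \<open>auto simp: tile_def\<close>)
        show "K \<inter> tile j \<subseteq> (\<Union>i\<in>Q j. E ` V i)"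
        proof
          fix w assume "w \<in> K \<inter> tile j"
          then obtain i z where "i \<in> I" "z \<in> V i" "E z = w" "j \<in> P i" using cover jJ by blast
          then show "w \<in> (\<Union>i\<in>Q j. E ` V i)" using j by (auto simp: Q_def T_def)
        qed
      qed
      also have "\<dots> \<le> (\<Sum>i\<in>Q j. (30 * real j) powr s * d i powr s)"
      proof (rule sum_mono)
        fix i assume i: "i \<in> Q j"
        then have iI: "i \<in> I" by (simp add: Q_def)
        have "bounded (E ` V i)"
          by (rule bounded_subset[of "tile j"]) (use V_tile i in \<open>auto simp: tile_def\<close>)
        then have "diameter (E ` V i) powr s \<le> (30 * real j * d i) powr s"
          using EV[OF i] s by (intro powr_mono2 diameter_ge_0) auto
        also have "\<dots> = (30 * real j) powr s * d i powr s"
          using d0[OF iI] by (intro powr_mult)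
        finally show "diameter (E ` V i) powr s \<le> (30 * real j) powr s * d i powr s" .
      qed
      also have "\<dots> = (30 * real j) powr s * (\<Sum>i\<in>Q j. d i powr s)" by (simp add: sum_distrib_left)
      finally show ?thesis using j0 by (simp add: powr_minus field_simps)
    qed
    have multi: "(\<Sum>j\<in>P i. (30 * real j) powr -s) \<le> d i powr s" if "i \<in> M" for i
      unfolding d_def using that bV d1 P_sub
      by (intro multi_tile_bound) (auto simp: M_def d_def P_def)
    have JT: "J - T \<subseteq> (\<Union>i\<in>M. P i)"
    proof
      fix j assume "j \<in> J - T"
      then obtain i where i: "i \<in> I" "j \<in> P i" "P i \<noteq> {j}" by (auto simp: T_def)
      then obtain j' where "j' \<in> P i" "j' \<noteq> j" by blast
      then have "card {j, j'} \<le> card (P i)" using i fin_P by (intro card_mono) auto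
      then have "i \<in> M" using i \<open>j' \<noteq> j\<close> by (auto simp: M_def)
      then show "j \<in> (\<Union>i\<in>M. P i)" using i by blast
    qed
    let ?m = "\<lambda>j. (30 * real j) powr -s"
    have finT: "finite T" using fin by (simp add: T_def)
    have "sum ?m (J - T) \<le> sum ?m (\<Union>i\<in>M. P i)"
      using JT finM fin_P by (intro sum_mono2) auto
    also have "\<dots> \<le> (\<Sum>i\<in>M. sum ?m (P i))"
      using finM fin_P by (intro sum_UN_le) auto
    also have "\<dots> \<le> (\<Sum>i\<in>M. d i powr s)" by (intro sum_mono multi)
    finally have le_M: "sum ?m (J - T) \<le> (\<Sum>i\<in>M. d i powr s)" .
    have "sum ?m T \<le> (\<Sum>j\<in>T. \<Sum>i\<in>Q j. d i powr s)"
      by (intro sum_mono single)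
    also have "\<dots> = (\<Sum>i\<in>(\<Union>j\<in>T. Q j). d i powr s)"
      by (rule sum.UNION_disjoint[symmetric]) (use finT finQ in \<open>auto simp: Q_def\<close>)
    finally have le_T: "sum ?m T \<le> (\<Sum>i\<in>(\<Union>j\<in>T. Q j). d i powr s)" .
    have "sum ?m J = sum ?m (J - T) + sum ?m T"
      using fin by (intro sum.subset_diff) (auto simp: T_def)
    also have "\<dots> \<le> (\<Sum>i\<in>M. d i powr s) + (\<Sum>i\<in>(\<Union>j\<in>T. Q j). d i powr s)"
      using le_M le_T by (rule add_mono)
    also have "\<dots> = (\<Sum>i\<in>M \<union> (\<Union>j\<in>T. Q j). d i powr s)"
    proof (rule sum.union_disjoint[symmetric])
      show "M \<inter> (\<Union>j\<in>T. Q j) = {}" by (auto simp: M_def Q_def)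
    qed (use finM finT finQ in auto)
    also have "\<dots> \<le> (\<Sum>i\<in>I. d i powr s)"
      using finI by (intro sum_mono2) (auto simp: Q_def M_def)
    finally show ?thesis using mass by simp
  qed
  also have "\<dots> \<le> (\<Sum>i\<in>I. diameter (U i) powr s)"
    using dU d0 s by (intro sum_mono powr_mono2) auto
  finally show ?case .
qed

lemma K_subset_julia_bd: "K \<subseteq> julia_bd E"
proof
  fix z assume z: "z \<in> K"
  have "L \<le> Re ((E ^^ n) z)" for n
    using z by (auto simp: K_def mem_tile)
  moreover have "bounded (\<Union>j\<in>J. tile j)" using fin by (auto simp: tile_def)
  then have "bounded (range (\<lambda>n. (E ^^ n) z))"
    by (rule bounded_subset) (use z in \<open>auto simp: K_def\<close>)
  ultimately show "z \<in> julia_bd E" using L by (intro expanding_bounded_orbit_in_julia_bd)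
qed

lemma hausdorff_dim_julia_bd_ge: "ereal s \<le> hausdorff_dim (julia_bd E)"
proof -
  obtain k where k: "k \<in> J" using mass by fastforce
  have "ereal s \<le> hausdorff_dim K"
  proof (rule compact_hausdorff_dim_ge[OF compact_K])
    fix I :: "nat set" and U assume "finite I" "\<And>i. i \<in> I \<Longrightarrow> bounded (U i)" "K \<subseteq> (\<Union>i\<in>I. U i)"
    then show "1 \<le> (\<Sum>i\<in>I. diameter (U i) powr s)"
      using k by (intro finite_cover_sum_ge_1) auto
  qed (use s in auto)
  also have "\<dots> \<le> hausdorff_dim (julia_bd E)"
    by (rule hausdorff_dim_mono[OF K_subset_julia_bd])
  finally show ?thesis .
qed

end

text \<open>
  For \<open>\<delta> = ln ln L / (2 ln L)\<close> one has \<open>L\<^sup>-\<^sup>\<delta> = 1 / sqrt (ln L)\<close>, so \<open>L\<^sup>-\<^sup>\<delta> / \<delta>\<close> tends to infinity,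
  while \<open>(L\<^sup>2)\<^sup>-\<^sup>\<delta> = 1 / ln L\<close> is negligible against \<open>L\<^sup>-\<^sup>\<delta>\<close>.
\<close>

lemma eventually_lower_exponent:
  "\<forall>\<^sub>F L :: real in at_top. 1 \<le> 30 powr -(1 + ln (ln L) / (2 * ln L)) *
     (((L + 1) powr -(ln (ln L) / (2 * ln L)) - (L\<^sup>2) powr -(ln (ln L) / (2 * ln L))) / (ln (ln L) / (2 * ln L)))"
  by real_asymp

text \<open>
  Tiles with numbers from \<open>L\<close> to \<open>L\<^sup>2\<close>: the telescoping bound turns the required sum into the
  quantity that was shown to be eventually at least \<open>1\<close>.
\<close>

lemma eventually_julia_bd_ge:
  "\<forall>\<^sub>F L in at_top. ereal (1 + ln (ln L) / (2 * ln L)) \<le> hausdorff_dim (julia_bd (exp_map (exp (-L))))"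
proof -
  have "\<forall>\<^sub>F L :: real in at_top. 2 \<le> L \<and> 0 < ln (ln L) / (2 * ln L) \<and> ln (10 * L\<^sup>2) \<le> L"
    by (intro eventually_conj) real_asymp+
  with eventually_lower_exponent show ?thesis
  proof eventually_elim
    case (elim L)
    define \<delta> where "\<delta> = ln (ln L) / (2 * ln L)"
    have L: "2 \<le> L" "ln (10 * L\<^sup>2) \<le> L" and \<delta>: "0 < \<delta>" using elim by (auto simp: \<delta>_def)
    define a b where "a = nat \<lceil>L\<rceil>" and "b = nat \<lfloor>L\<^sup>2\<rfloor>"
    have a: "L \<le> real a" "real a \<le> L + 1" using L by (auto simp: a_def)
    have LL: "2 * L \<le> L\<^sup>2" using L by (simp add: power2_eq_square)
    then have b: "real b \<le> L\<^sup>2" "L\<^sup>2 \<le> real b + 1" using L by (auto simp: b_def)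
    have ab: "0 < a" "a \<le> b" using L a b LL by linarith+
    interpret expanding_tiles L "1 + \<delta>" "{a..b}"
    proof
      fix j assume "j \<in> {a..b}"
      then have j: "real a \<le> real j" "real j \<le> real b" by auto
      then show "L \<le> real j" using a by linarith
      have "ln (10 * real j) \<le> ln (10 * L\<^sup>2)" using j ab b L a by (subst ln_le_cancel_iff) auto
      then show "ln (10 * real j) \<le> L" using L by linarith
    next
      have "1 \<le> 30 powr -(1 + \<delta>) * (((L + 1) powr -\<delta> - (L\<^sup>2) powr -\<delta>) / \<delta>)"
        using elim by (simp add: \<delta>_def)
      also have "\<dots> \<le> 30 powr -(1 + \<delta>) * ((real a powr -\<delta> - (real b + 1) powr -\<delta>) / \<delta>)"
        using a b L \<delta> by (intro mult_left_mono divide_right_mono diff_mono powr_mono2') auto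
      also have "\<dots> \<le> 30 powr -(1 + \<delta>) * (\<Sum>j=a..b. real j powr -(1 + \<delta>))"
        using ab \<delta> by (intro mult_left_mono sum_powr_ge) auto
      also have "\<dots> = (\<Sum>j=a..b. (30 * real j) powr -(1 + \<delta>))"
        by (simp add: sum_distrib_left powr_mult)
      finally show "1 \<le> (\<Sum>j=a..b. (30 * real j) powr -(1 + \<delta>))" .
    qed (use L \<delta> in auto)
    show ?case using hausdorff_dim_julia_bd_ge by (simp add: \<delta>_def)
  qed
qed

section \<open>Both bounds in terms of the parameter\<close>

theorem mainTheorem2:
  shows "\<exists>c\<^sub>0 :: real. 0 < c\<^sub>0 \<and> c\<^sub>0 < 1 / exp 1 \<and>
    (\<forall>c :: real. 0 < c \<and> c \<le> c\<^sub>0 \<longrightarrow>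
      ereal (1 + 1 / 2 * (ln (ln (ln (1 / c))) / ln (ln (1 / c)))
               - ln (ln (ln (ln (1 / c)))) / ln (ln (1 / c)))
        < hausdorff_dim (julia_bd (exp_map c)) \<and>
      hausdorff_dim (julia_bd (exp_map c)) \<le> hausdorff_dim (julia_r (exp_map c)) \<and>
      hausdorff_dim (julia_r (exp_map c))
        \<le> ereal (1 + ln (ln (ln (1 / c))) / ln (ln (1 / c))))"
proof -
  have "\<forall>\<^sub>F L :: real in at_top. 0 < ln (ln (ln L)) / ln L" by real_asymp
  with eventually_julia_bd_ge eventually_julia_r_le
  have "\<forall>\<^sub>F L in at_top.
      ereal (1 + 1 / 2 * (ln (ln L) / ln L) - ln (ln (ln L)) / ln L) < hausdorff_dim (julia_bd (exp_map (exp (-L)))) \<and>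
      hausdorff_dim (julia_r (exp_map (exp (-L)))) \<le> ereal (1 + ln (ln L) / ln L)"
  proof eventually_elim
    case (elim L)
    then have "ereal (1 + 1 / 2 * (ln (ln L) / ln L) - ln (ln (ln L)) / ln L) < ereal (1 + ln (ln L) / (2 * ln L))"
      by simp
    from less_le_trans[OF this elim(1)] elim(2) show ?case by blast
  qed
  then obtain L\<^sub>0 where L0: "\<And>L. L\<^sub>0 \<le> L \<Longrightarrow>
      ereal (1 + 1 / 2 * (ln (ln L) / ln L) - ln (ln (ln L)) / ln L) < hausdorff_dim (julia_bd (exp_map (exp (-L)))) \<and>
      hausdorff_dim (julia_r (exp_map (exp (-L)))) \<le> ereal (1 + ln (ln L) / ln L)"
    unfolding eventually_at_top_linorder by blast
  show ?thesis
  proof (intro exI[of _ "exp (- max L\<^sub>0 2)"] conjI allI impI)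
    show "exp (- max L\<^sub>0 2) < 1 / exp (1::real)"
      by (simp add: exp_minus[symmetric] divide_inverse)
    fix c :: real assume c: "0 < c \<and> c \<le> exp (- max L\<^sub>0 2)"
    have "ln c \<le> - max L\<^sub>0 2" using c by (metis ln_exp ln_le_cancel_iff exp_gt_zero)
    then have "L\<^sub>0 \<le> ln (1 / c)" using c by (simp add: ln_div)
    note * = L0[OF this]
    have eq: "exp (- ln (1 / c)) = c" using c by (simp add: ln_div)
    show "ereal (1 + 1 / 2 * (ln (ln (ln (1 / c))) / ln (ln (1 / c)))
               - ln (ln (ln (ln (1 / c)))) / ln (ln (1 / c)))
        < hausdorff_dim (julia_bd (exp_map c))"
      using * unfolding eq by blast
    show "hausdorff_dim (julia_r (exp_map c)) \<le> ereal (1 + ln (ln (ln (1 / c))) / ln (ln (1 / c)))"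
      using * unfolding eq by blast
    show "hausdorff_dim (julia_bd (exp_map c)) \<le> hausdorff_dim (julia_r (exp_map c))"
      by (rule hausdorff_dim_mono[OF julia_bd_subset_julia_r])
  qed simp
qed

end
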